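(* Let $M^{n} \subset \mathbb{R}^{n+1}$ be a connected helix hypersurface with constant mean curvature. Then $M$ is either (locally) a cylinder $M = \mathbb{R} \times N \subset \mathbb{R} \times \mathbb{R}^{n} = \mathbb{R}^{n+1}$ over a hypersurface $N \subset \mathbb{R}^{n}$ with constant mean curvature, or an open subset of a hyperplane, i.e. $M$ is a totally geodesic hypersurface of $\mathbb{R}^{n+1}$.
   Context: A hypersurface $M\subset\mathbb{R}^{n+1}$ is a helix if there is a fixed nonzero vector $d\in\mathbb{R}^{n+1}$ such that the angle $\angle(T_pM,d)\in[0,\pi/2]$ between $T_pM$ and $d$ (determined by $\|d^\top\|=\|d\|\cos\angle(T_pM,d)$, with $d^\top$ the component of $d$ tangent to $M$ at $p$) does not depend on $p\in M$. All claims are of local nature: "$M=\mathbb{R}\times N$" means that, after a rigid motion, near each of its points $M$ coincides with an open part of such a product. *)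

theory Defs
  imports "HOL-Analysis.Analysis"
begin

text \<open>Smooth means \<open>C\<^sup>\<infinity>\<close>. The set \<open>S\<close> is meant to be open.\<close>

primrec Ck_on :: "nat \<Rightarrow> ('a::euclidean_space \<Rightarrow> 'b::euclidean_space) \<Rightarrow> 'a set \<Rightarrow> bool" where
  "Ck_on 0 f S \<longleftrightarrow> continuous_on S f"
| "Ck_on (Suc k) f S \<longleftrightarrow>
     (\<forall>x\<in>S. f differentiable (at x)) \<and> (\<forall>v. Ck_on k (\<lambda>x. frechet_derivative f (at x) v) S)"

definition smooth_on :: "('a::euclidean_space \<Rightarrow> 'b::euclidean_space) \<Rightarrow> 'a set \<Rightarrow> bool" where
  "smooth_on f S \<longleftrightarrow> (\<forall>k. Ck_on k f S)"

text \<open>Hypersurfaces are smooth embedded submanifolds of codimension one (not necessarily closed,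
  connected or orientable), described locally as regular level sets.\<close>

definition hypersurface :: "'a::euclidean_space set \<Rightarrow> bool" where
  "hypersurface M \<longleftrightarrow>
     (\<forall>p\<in>M. \<exists>U. \<exists>g :: 'a \<Rightarrow> real. open U \<and> p \<in> U \<and> smooth_on g U \<and>
        M \<inter> U = {x \<in> U. g x = 0} \<and>
        (\<forall>x\<in>M \<inter> U. \<exists>v. frechet_derivative g (at x) v \<noteq> 0))"

text \<open>Tangent vectors are the velocities of curves in \<open>M\<close>.\<close>

definition tangent_space :: "'a::euclidean_space set \<Rightarrow> 'a \<Rightarrow> 'a set" where
  "tangent_space M p =
     {v. \<exists>\<gamma> :: real \<Rightarrow> 'a. \<gamma> 0 = p \<and> (\<forall>\<^sub>F t in nhds 0. \<gamma> t \<in> M) \<and>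
         (\<gamma> has_vector_derivative v) (at 0)}"

definition tangential_component :: "'a::euclidean_space set \<Rightarrow> 'a \<Rightarrow> 'a \<Rightarrow> 'a" where
  "tangential_component M p d =
     (THE w. w \<in> tangent_space M p \<and> (\<forall>v\<in>tangent_space M p. (d - w) \<bullet> v = 0))"

definition tangent_angle :: "'a::euclidean_space set \<Rightarrow> 'a \<Rightarrow> 'a \<Rightarrow> real" where
  "tangent_angle M p d =
     (THE \<theta>. \<theta> \<in> {0..pi / 2} \<and> norm (tangential_component M p d) = norm d * cos \<theta>)"

definition helix :: "'a::euclidean_space set \<Rightarrow> bool" where
  "helix M \<longleftrightarrow> (\<exists>d. d \<noteq> 0 \<and> (\<exists>\<theta>. \<forall>p\<in>M. tangent_angle M p d = \<theta>))"

text \<open>A unit normal field along the open part \<open>M \<inter> U\<close> of \<open>M\<close> is given by a smooth extension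
  \<open>\<nu>\<close> to \<open>U\<close>. Derivatives of \<open>\<nu>\<close> are only taken in directions tangent to \<open>M\<close>, where they
  depend only on the values of \<open>\<nu>\<close> on \<open>M\<close>.\<close>

definition unit_normal_field ::
    "'a::euclidean_space set \<Rightarrow> 'a set \<Rightarrow> ('a \<Rightarrow> 'a) \<Rightarrow> bool" where
  "unit_normal_field M U \<nu> \<longleftrightarrow> open U \<and> smooth_on \<nu> U \<and>
     (\<forall>q\<in>M \<inter> U. norm (\<nu> q) = 1 \<and> (\<forall>v\<in>tangent_space M q. \<nu> q \<bullet> v = 0))"

definition shape_operator :: "('a::euclidean_space \<Rightarrow> 'a) \<Rightarrow> 'a \<Rightarrow> 'a \<Rightarrow> 'a" where
  "shape_operator \<nu> q v = - frechet_derivative \<nu> (at q) v"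

definition orthonormal_basis :: "'a::euclidean_space set \<Rightarrow> 'a set \<Rightarrow> bool" where
  "orthonormal_basis B V \<longleftrightarrow> pairwise orthogonal B \<and> (\<forall>b\<in>B. norm b = 1) \<and> span B = V"

text \<open>The mean curvature is the trace of the shape operator on the tangent space, divided by the
  dimension of the hypersurface. The trace does not depend on the orthonormal basis chosen.
  A hypersurface of a one-dimensional space is discrete and gets mean curvature \<open>0\<close>.\<close>

definition mean_curvature :: "'a::euclidean_space set \<Rightarrow> ('a \<Rightarrow> 'a) \<Rightarrow> 'a \<Rightarrow> real" where
  "mean_curvature M \<nu> q =
     (\<Sum>b\<in>(SOME B. orthonormal_basis B (tangent_space M q)). shape_operator \<nu> q b \<bullet> b) /
     (real DIM('a) - 1)"

text \<open>The sign of the mean curvature depends on the unit normal, so constancy is expressed with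
  local unit normal fields; \<open>M\<close> need not be orientable.\<close>

definition constant_mean_curvature :: "'a::euclidean_space set \<Rightarrow> bool" where
  "constant_mean_curvature M \<longleftrightarrow>
     (\<exists>H. \<forall>p\<in>M. \<exists>U \<nu>. p \<in> U \<and> unit_normal_field M U \<nu> \<and>
        (\<forall>q\<in>M \<inter> U. mean_curvature M \<nu> q = H))"

definition totally_geodesic :: "'a::euclidean_space set \<Rightarrow> bool" where
  "totally_geodesic M \<longleftrightarrow>
     (\<forall>p\<in>M. \<exists>U \<nu>. p \<in> U \<and> unit_normal_field M U \<nu> \<and>
        (\<forall>q\<in>M \<inter> U. \<forall>v\<in>tangent_space M q. \<forall>w\<in>tangent_space M q.
           shape_operator \<nu> q v \<bullet> w = 0))"

definition rigid_motion :: "('a::euclidean_space \<Rightarrow> 'a) \<Rightarrow> bool" where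
  "rigid_motion T \<longleftrightarrow> (\<exists>f c. orthogonal_transformation f \<and> T = (\<lambda>x. f x + c))"

text \<open>One rigid motion serves for all points, whereas the base \<open>N\<close> may vary with the point.\<close>

definition locally_cmc_cylinder :: "(real \<times> (real ^ 'n)) set \<Rightarrow> bool" where
  "locally_cmc_cylinder M \<longleftrightarrow>
     (\<exists>T. rigid_motion T \<and>
        (\<forall>p\<in>M. \<exists>U. \<exists>N :: (real ^ 'n) set. open U \<and> p \<in> U \<and>
           hypersurface N \<and> constant_mean_curvature N \<and>
           openin (top_of_set (UNIV \<times> N)) (T ` (M \<inter> U))))"

definition open_in_hyperplane :: "'a::euclidean_space set \<Rightarrow> bool" where
  "open_in_hyperplane M \<longleftrightarrow> (\<exists>a b. a \<noteq> 0 \<and> openin (top_of_set {x. a \<bullet> x = b}) M)"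

end

theory Submission
  imports Defs
begin

text \<open>Let \<open>d\<close> be the unit axis of the helix. The helix condition says that \<open>\<bar>\<nu> \<bullet> d\<bar> = K\<close> is constant
  for unit normals \<open>\<nu>\<close>. If \<open>K = 0\<close>, then \<open>d\<close> is tangent everywhere, an implicit function describing
  \<open>M\<close> is constant along \<open>d\<close>, and \<open>M\<close> is locally a product whose base has the same trace of
  the shape operator, since \<open>d\<close> is a principal direction of curvature zero.

  If \<open>K \<noteq> 0\<close>, then \<open>M\<close> is locally a graph in direction \<open>d\<close>. Extending \<open>\<nu>\<close> constantly along \<open>d\<close>
  gives a unit vector field \<open>N\<close> on an open set. It is a constant multiple of the gradient of the
  function whose level sets are the translates of \<open>M\<close>, and its divergence is a multiple of the mean
  curvature. Hence Bochner's formula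
  \<open>0 = \<Delta> \<bar>N\<bar>\<^sup>2 / 2 = \<bar>DN\<bar>\<^sup>2 + N \<bullet> \<nabla>(div N)\<close> yields \<open>DN = 0\<close>, so \<open>M\<close> is locally
  a hyperplane, and globally one by connectedness.\<close>

section \<open>The Bochner argument\<close>

text \<open>The mean value theorem is applied along \<open>v\<close>; differentiability of
  \<open>h' _ v\<close> at the single point \<open>x\<close> then controls the increment along
  \<open>w\<close>. The quotient is symmetric in \<open>v\<close> and \<open>w\<close> although its
  limit is computed asymmetrically, which is what makes it useful.\<close>

lemma second_difference_quotient_tendsto:
  fixes h :: "'a::real_normed_vector \<Rightarrow> real"
  assumes "open W" "x \<in> W"
    and h: "\<And>y. y \<in> W \<Longrightarrow> (h has_derivative h' y) (at y)"
    and A: "((\<lambda>y. h' y v) has_derivative A) (at x)"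
  shows "((\<lambda>t. (h (x + t *\<^sub>R v + t *\<^sub>R w) - h (x + t *\<^sub>R v) - h (x + t *\<^sub>R w) + h x) / t\<^sup>2)
            \<longlongrightarrow> A w) (at_right 0)"
proof (rule tendstoI)
  fix e :: real assume "e > 0"
  interpret A: bounded_linear A using A by (rule has_derivative_bounded_linear)
  \<comment> \<open>\<open>t * C\<close> bounds both displacements from \<open>x\<close>, and
    \<open>C\<close> also bounds the sum of the two remainder factors, so
    \<open>e' * C = e / 2\<close> closes the estimate.\<close>
  define C where "C = 2 * norm v + norm w + 1"
  have C: "C > 0" by (simp add: C_def add_nonneg_pos)
  define e' where "e' = e / (2 * C)"
  have e': "e' > 0" using \<open>e > 0\<close> C by (simp add: e'_def)
  obtain r where r: "r > 0" "\<And>y. norm (y - x) < r \<Longrightarrow>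
      norm (h' y v - h' x v - A (y - x)) \<le> e' * norm (y - x)"
    using A e' unfolding has_derivative_at_alt by meson
  obtain r' where r': "r' > 0" "ball x r' \<subseteq> W"
    using assms(1,2) by (meson openE)
  define \<delta> where "\<delta> = min r r' / C"
  have \<delta>: "\<delta> > 0" using r r' C by (simp add: \<delta>_def)
  have "dist ((h (x + t *\<^sub>R v + t *\<^sub>R w) - h (x + t *\<^sub>R v) - h (x + t *\<^sub>R w) + h x) / t\<^sup>2) (A w) < e"
    if t: "0 < t" "t < \<delta>" for t
  proof -
    have tC: "t * C < min r r'" using t C by (simp add: \<delta>_def field_simps)
    have small: "norm (s *\<^sub>R v) \<le> t * norm v \<and> norm (s *\<^sub>R v + t *\<^sub>R w) \<le> t * (norm v + norm w) \<and>
        norm (s *\<^sub>R v) < min r r' \<and> norm (s *\<^sub>R v + t *\<^sub>R w) < min r r'" if "0 \<le> s" "s \<le> t" for s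
    proof -
      have 1: "norm (s *\<^sub>R v) \<le> t * norm v" using that by (simp add: mult_right_mono)
      have 2: "norm (s *\<^sub>R v + t *\<^sub>R w) \<le> t * (norm v + norm w)"
        using norm_triangle_ineq[of "s *\<^sub>R v" "t *\<^sub>R w"] 1 t by (simp add: algebra_simps)
      have "t * norm v \<le> t * C" "t * (norm v + norm w) \<le> t * C"
        using t by (auto simp: C_def intro!: mult_left_mono add_nonneg_nonneg)
      then show ?thesis using 1 2 tC by linarith
    qed
    \<comment> \<open>The second difference is the change of this increment along \<open>w\<close>
      as the base point moves along \<open>v\<close>.\<close>
    define u where "u s = h (x + s *\<^sub>R v + t *\<^sub>R w) - h (x + s *\<^sub>R v)" for s
    have inW: "x + s *\<^sub>R v + t *\<^sub>R w \<in> W \<and> x + s *\<^sub>R v \<in> W" if "0 \<le> s" "s \<le> t" for s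
    proof -
      have "dist x (x + z) = norm z" for z by (simp add: dist_norm)
      then have "x + (s *\<^sub>R v + t *\<^sub>R w) \<in> ball x r'" "x + s *\<^sub>R v \<in> ball x r'"
        using small[OF that] by auto
      then show ?thesis using r' by (auto simp: add.assoc)
    qed
    have chain: "((\<lambda>s. h (x + s *\<^sub>R v + z)) has_derivative (\<lambda>k. k * h' (x + s *\<^sub>R v + z) v)) (at s)"
      if "x + s *\<^sub>R v + z \<in> W" for s z
    proof -
      have "((\<lambda>s. h (x + s *\<^sub>R v + z)) has_derivative (\<lambda>k. h' (x + s *\<^sub>R v + z) (k *\<^sub>R v))) (at s)"
      proof -
        have "((\<lambda>s. x + s *\<^sub>R v + z) has_derivative (\<lambda>k. k *\<^sub>R v)) (at s)"
          by (auto intro!: derivative_eq_intros)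
        from has_derivative_compose[OF this, of h] h[OF that] show ?thesis by blast
      qed
      moreover have "bounded_linear (h' (x + s *\<^sub>R v + z))"
        using h[OF that] by (rule has_derivative_bounded_linear)
      ultimately show ?thesis
        by (simp add: linear_simps(5))
    qed
    have du: "(u has_real_derivative (h' (x + s *\<^sub>R v + t *\<^sub>R w) v - h' (x + s *\<^sub>R v) v)) (at s)"
      if "0 \<le> s" "s \<le> t" for s
      unfolding u_def has_field_derivative_def
      using has_derivative_diff[OF chain[of s "t *\<^sub>R w"] chain[of s 0]] inW[OF that]
      by (simp only: add_0_right right_diff_distrib[symmetric] mult_commute_abs)
    obtain s where s: "0 < s" "s < t"
      "u t - u 0 = t * (h' (x + s *\<^sub>R v + t *\<^sub>R w) v - h' (x + s *\<^sub>R v) v)"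
    proof -
      have "\<exists>s. 0 < s \<and> s < t \<and> u t - u 0 = (t - 0) * (h' (x + s *\<^sub>R v + t *\<^sub>R w) v - h' (x + s *\<^sub>R v) v)"
        by (rule MVT2[OF t(1) du])
      then show thesis using that by auto
    qed
    \<comment> \<open>\<open>E1\<close> and \<open>E2\<close> are first-order remainders of
      \<open>h' _ v\<close> at the two points. In the difference of the linear parts the unknown
      \<open>s\<close> cancels, leaving \<open>t * A w\<close>.\<close>
    define E1 where "E1 = h' (x + (s *\<^sub>R v + t *\<^sub>R w)) v - h' x v - A (s *\<^sub>R v + t *\<^sub>R w)"
    define E2 where "E2 = h' (x + s *\<^sub>R v) v - h' x v - A (s *\<^sub>R v)"
    have sm: "norm (s *\<^sub>R v) \<le> t * norm v" "norm (s *\<^sub>R v + t *\<^sub>R w) \<le> t * (norm v + norm w)"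
        "norm (s *\<^sub>R v) < r" "norm (s *\<^sub>R v + t *\<^sub>R w) < r"
      using small[of s] s by auto
    have E1: "\<bar>E1\<bar> \<le> e' * (t * (norm v + norm w))"
      using order_trans[OF r(2)[of "x + (s *\<^sub>R v + t *\<^sub>R w)"] mult_left_mono[OF _ less_imp_le[OF e']]] sm
      by (simp add: E1_def)
    have E2: "\<bar>E2\<bar> \<le> e' * (t * norm v)"
      using order_trans[OF r(2)[of "x + s *\<^sub>R v"] mult_left_mono[OF _ less_imp_le[OF e']]] sm
      by (simp add: E2_def)
    have "u t - u 0 = t * (E1 - E2 + t * A w)"
      unfolding s(3) E1_def E2_def by (simp add: A.add A.scaleR add.assoc)
    then have "(u t - u 0) / t\<^sup>2 - A w = t * (E1 - E2 + t * A w) / t\<^sup>2 - A w"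
      by simp
    also have "\<dots> = (E1 - E2) / t"
      using t by (simp add: field_simps power2_eq_square)
    finally have "(u t - u 0) / t\<^sup>2 - A w = (E1 - E2) / t" .
    then have "\<bar>(u t - u 0) / t\<^sup>2 - A w\<bar> \<le> (e' * (t * (norm v + norm w)) + e' * (t * norm v)) / t"
      using E1 E2 t by (simp add: abs_divide divide_right_mono)
    also have "\<dots> = e' * (2 * norm v + norm w)" using t by (simp add: field_simps)
    also have "\<dots> \<le> e' * C" using e' by (simp add: C_def)
    also have "\<dots> < e" using C \<open>e > 0\<close> by (simp add: e'_def)
    finally show ?thesis by (simp add: u_def dist_real_def algebra_simps)
  qed
  then show "\<forall>\<^sub>F t in at_right 0.
      dist ((h (x + t *\<^sub>R v + t *\<^sub>R w) - h (x + t *\<^sub>R v) - h (x + t *\<^sub>R w) + h x) / t\<^sup>2) (A w) < e"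
    unfolding eventually_at_right_field using \<delta> by auto
qed

text \<open>Both sides are limits of the same quotient, since exchanging \<open>v\<close> and
  \<open>w\<close> leaves it unchanged.\<close>

lemma symmetric_second_derivative:
  fixes h :: "'a::real_normed_vector \<Rightarrow> real"
  assumes "open W" "x \<in> W"
    and "\<And>y. y \<in> W \<Longrightarrow> (h has_derivative h' y) (at y)"
    and "((\<lambda>y. h' y v) has_derivative A) (at x)"
    and "((\<lambda>y. h' y w) has_derivative B) (at x)"
  shows "A w = B v"
proof -
  have "((\<lambda>t. (h (x + t *\<^sub>R v + t *\<^sub>R w) - h (x + t *\<^sub>R v) - h (x + t *\<^sub>R w) + h x) / t\<^sup>2)
            \<longlongrightarrow> B v) (at_right 0)"
    using second_difference_quotient_tendsto[OF assms(1-3,5), of v]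
    by (simp add: algebra_simps)
  then show ?thesis
    using second_difference_quotient_tendsto[OF assms(1-4), of w]
    by (rule tendsto_unique[OF trivial_limit_at_right_real, rotated])
qed

text \<open>Bochner's argument in first-order form; \<open>sym\<close> says that \<open>N\<close> is
  locally a gradient field. Differentiating \<open>N' y (N y) = 0\<close> once, pairing with
  \<open>w\<close> and tracing over \<open>w\<close> leaves the squared norm of \<open>N'\<close>
  plus the derivative of the divergence along \<open>N\<close>, and the latter vanishes.\<close>

lemma divergence_constant_gradient_constant:
  fixes N :: "'a::euclidean_space \<Rightarrow> 'a"
  assumes W: "open W" and x: "x \<in> W"
    and der: "\<And>y. y \<in> W \<Longrightarrow> (N has_derivative N' y) (at y)"
    and der2: "\<And>y v. y \<in> W \<Longrightarrow> (\<lambda>z. N' z v) differentiable (at y)"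
    and sym: "\<And>y v w. y \<in> W \<Longrightarrow> N' y v \<bullet> w = N' y w \<bullet> v"
    and unit: "\<And>y. y \<in> W \<Longrightarrow> norm (N y) = 1"
    and div: "\<And>y. y \<in> W \<Longrightarrow> (\<Sum>b\<in>Basis. N' y b \<bullet> b) = k"
  shows "N' x = (\<lambda>v. 0)"
proof -
  define S where "S v = frechet_derivative (\<lambda>z. N' z v) (at x)" for v
  have S: "((\<lambda>z. N' z v) has_derivative S v) (at x)" for v
    using der2[OF x] by (simp add: S_def frechet_derivative_works[symmetric])
  have lin: "linear (N' y)" if "y \<in> W" for y
    using der[OF that] has_derivative_linear by blast
  have S_sym: "S v w \<bullet> u = S w v \<bullet> u" for v w u
  proof (rule symmetric_second_derivative[OF W x, where h = "\<lambda>y. N y \<bullet> u" and h' = "\<lambda>y v. N' y v \<bullet> u"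
        and A = "\<lambda>w. S v w \<bullet> u" and B = "\<lambda>v. S w v \<bullet> u"])
  qed (auto intro!: derivative_eq_intros der S)
  \<comment> \<open>Unit length makes every \<open>N' y v\<close> orthogonal to \<open>N y\<close>;
    symmetry then moves \<open>N y\<close> into the argument.\<close>
  have N'N: "N' y (N y) = 0" if y: "y \<in> W" for y
  proof -
    have "((\<lambda>y. N y \<bullet> N y) has_derivative (\<lambda>v. N y \<bullet> N' y v + N' y v \<bullet> N y)) (at y)"
      by (intro has_derivative_inner der y)
    moreover have "((\<lambda>y. N y \<bullet> N y) has_derivative (\<lambda>v. 0)) (at y)"
      by (rule has_derivative_transform_within_open[OF has_derivative_const[of 1] W y])
         (use unit in \<open>simp add: dot_square_norm\<close>)
    ultimately have "(\<lambda>v. N y \<bullet> N' y v + N' y v \<bullet> N y) = (\<lambda>v. 0)"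
      by (rule has_derivative_unique)
    then have "N y \<bullet> N' y v + N' y v \<bullet> N y = 0" for v
      by (rule fun_cong)
    then have "N' y v \<bullet> N y = 0" for v
      by (simp add: inner_commute)
    then have "N' y (N y) \<bullet> v = 0" for v
      using sym[OF y] by metis
    then show ?thesis by (metis inner_eq_zero_iff)
  qed
  have expand: "(\<Sum>b\<in>Basis. (z \<bullet> b) *\<^sub>R N' y b) = N' y z" if "y \<in> W" for y z
    by (metis (no_types, lifting) euclidean_representation lin linear_scale linear_sum sum.cong that)
  \<comment> \<open>\<open>N' y (N y)\<close> is expanded over \<open>Basis\<close> because second
    derivatives are given only for fixed directions.\<close>
  have "((\<lambda>y. \<Sum>b\<in>Basis. (N y \<bullet> b) *\<^sub>R N' y b) has_derivative
      (\<lambda>w. \<Sum>b\<in>Basis. (N x \<bullet> b) *\<^sub>R S b w + (N' x w \<bullet> b) *\<^sub>R N' x b)) (at x)"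
    by (intro has_derivative_sum has_derivative_scaleR has_derivative_inner_left der S x)
  moreover have "((\<lambda>y. \<Sum>b\<in>Basis. (N y \<bullet> b) *\<^sub>R N' y b) has_derivative (\<lambda>w. 0)) (at x)"
    by (rule has_derivative_transform_within_open[OF has_derivative_const[of 0] W x])
       (simp add: expand N'N)
  ultimately have "(\<lambda>w. \<Sum>b\<in>Basis. (N x \<bullet> b) *\<^sub>R S b w + (N' x w \<bullet> b) *\<^sub>R N' x b) = (\<lambda>w. 0)"
    by (rule has_derivative_unique)
  then have "(\<Sum>b\<in>Basis. (N x \<bullet> b) *\<^sub>R S b w + (N' x w \<bullet> b) *\<^sub>R N' x b) = 0" for w
    by (rule fun_cong)
  then have "(\<Sum>b\<in>Basis. (N x \<bullet> b) *\<^sub>R S b w) + N' x (N' x w) = 0" for w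
    by (simp only: sum.distrib expand[OF x])
  then have key: "(\<Sum>b\<in>Basis. (N x \<bullet> b) * (S b w \<bullet> w)) + N' x w \<bullet> N' x w = 0" for w
  proof -
    have "((\<Sum>b\<in>Basis. (N x \<bullet> b) *\<^sub>R S b w) + N' x (N' x w)) \<bullet> w = 0"
      using \<open>\<And>w. (\<Sum>b\<in>Basis. (N x \<bullet> b) *\<^sub>R S b w) + N' x (N' x w) = 0\<close> by simp
    then show ?thesis
      using sym[OF x, of "N' x w" w] by (simp add: inner_add_left inner_sum_left)
  qed
  \<comment> \<open>Symmetry of second derivatives turns this trace into the derivative of the
    divergence in direction \<open>b\<close>.\<close>
  have trS: "(\<Sum>c\<in>Basis. S b c \<bullet> c) = 0" for b
  proof -
    have "((\<lambda>y. \<Sum>c\<in>Basis. N' y c \<bullet> c) has_derivative (\<lambda>w. \<Sum>c\<in>Basis. S c w \<bullet> c)) (at x)"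
      by (intro has_derivative_sum has_derivative_inner_left S)
    moreover have "((\<lambda>y. \<Sum>c\<in>Basis. N' y c \<bullet> c) has_derivative (\<lambda>w. 0)) (at x)"
      by (rule has_derivative_transform_within_open[OF has_derivative_const[of k] W x])
         (simp add: div)
    ultimately have "(\<lambda>w. \<Sum>c\<in>Basis. S c w \<bullet> c) = (\<lambda>w. 0)"
      by (rule has_derivative_unique)
    then have "(\<Sum>c\<in>Basis. S c b \<bullet> c) = 0"
      by (rule fun_cong)
    then show ?thesis using S_sym[of b] by simp
  qed
  have "(\<Sum>w\<in>Basis. (\<Sum>b\<in>Basis. (N x \<bullet> b) * (S b w \<bullet> w)) + N' x w \<bullet> N' x w) = 0"
    using key by simp
  moreover have "(\<Sum>w\<in>Basis. \<Sum>b\<in>Basis. (N x \<bullet> b) * (S b w \<bullet> w)) = 0"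
    by (subst sum.swap) (simp add: trS sum_distrib_left[symmetric])
  ultimately have "(\<Sum>w\<in>Basis. N' x w \<bullet> N' x w) = 0"
    by (simp add: sum.distrib)
  then have "\<forall>w\<in>Basis. N' x w = 0"
    by (subst (asm) sum_nonneg_eq_0_iff) auto
  then show ?thesis
    using expand[OF x] by (metis (no_types, lifting) ext scaleR_zero_right sum.neutral)
qed

section \<open>Smooth maps and implicit functions\<close>

lemma Ck_on_subset: "Ck_on k f S \<Longrightarrow> T \<subseteq> S \<Longrightarrow> Ck_on k f T"
  by (induction k arbitrary: f) (auto intro: continuous_on_subset)

lemma smooth_on_subset: "smooth_on f S \<Longrightarrow> T \<subseteq> S \<Longrightarrow> smooth_on f T"
  unfolding smooth_on_def using Ck_on_subset by blast

lemma Ck_on_cong: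
  assumes "open S" "\<And>x. x \<in> S \<Longrightarrow> f x = g x" "Ck_on k f S"
  shows "Ck_on k g S"
  using assms(2,3)
proof (induction k arbitrary: f g)
  case 0
  then show ?case by (simp cong: continuous_on_cong)
next
  case (Suc k)
  have diff: "f differentiable (at x)" if "x \<in> S" for x
    using Suc.prems(2) that by simp
  have "frechet_derivative f (at x) = frechet_derivative g (at x)" if "x \<in> S" for x
    using frechet_derivative_transform_within_open[OF diff[OF that] \<open>open S\<close> that] Suc.prems(1) by blast
  then have "Ck_on k (\<lambda>x. frechet_derivative g (at x) v) S" for v
    using Suc.IH[of "\<lambda>x. frechet_derivative f (at x) v"] Suc.prems(2) by simp
  moreover have "g differentiable (at x)" if "x \<in> S" for x
    using diff[OF that] Suc.prems(1) \<open>open S\<close> that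
    by (metis differentiable_def has_derivative_transform_within_open)
  ultimately show ?case by simp
qed

lemma smooth_on_const [simp]: "smooth_on (\<lambda>x. c) S"
proof -
  have "Ck_on k (\<lambda>x. c) S" for k
    by (induction k arbitrary: c) auto
  then show ?thesis by (simp add: smooth_on_def)
qed

lemma smooth_on_has_derivative:
  assumes "smooth_on f S" "x \<in> S"
  shows "(f has_derivative frechet_derivative f (at x)) (at x)"
proof -
  have "Ck_on (Suc 0) f S" using assms(1) smooth_on_def by blast
  then show ?thesis using assms(2) by (simp add: frechet_derivative_works)
qed

lemma smooth_on_imp_continuous_on: "smooth_on f S \<Longrightarrow> continuous_on S f"
  unfolding smooth_on_def using Ck_on.simps(1) by blast

lemma smooth_on_frechet_derivative:
  assumes "smooth_on f S"
  shows "smooth_on (\<lambda>x. frechet_derivative f (at x) v) S"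
  using assms unfolding smooth_on_def by (metis Ck_on.simps(2))

lemma frechet_derivative_affine_compose:
  fixes J :: "'b::euclidean_space \<Rightarrow> 'a::euclidean_space" and P :: "'c::euclidean_space \<Rightarrow> 'd::euclidean_space"
  assumes "linear J" "linear P" "f differentiable (at (a + J y))"
  shows "((\<lambda>y. P (f (a + J y))) has_derivative
           (\<lambda>v. P (frechet_derivative f (at (a + J y)) (J v)))) (at y)"
proof -
  have "((\<lambda>y. a + J y) has_derivative J) (at y)"
    using has_derivative_add[OF has_derivative_const linear_imp_has_derivative[OF assms(1)]] by simp
  from has_derivative_compose[OF this, of f] assms(3)
  have "((\<lambda>y. f (a + J y)) has_derivative (\<lambda>v. frechet_derivative f (at (a + J y)) (J v))) (at y)"
    by (simp add: frechet_derivative_works)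
  from has_derivative_compose[OF this linear_imp_has_derivative[OF assms(2)]]
  show ?thesis by simp
qed

text \<open>Maps of this form are closed under differentiation: the derivative along
  \<open>v\<close> has the same form, with \<open>f\<close> replaced by its derivative along
  \<open>J v\<close>. This drives an induction on \<open>k\<close> with \<open>f\<close> arbitrary.
  It serves to restrict equations and normals to affine slices.\<close>

lemma smooth_on_affine_compose:
  fixes J :: "'b::euclidean_space \<Rightarrow> 'a::euclidean_space" and P :: "'c::euclidean_space \<Rightarrow> 'd::euclidean_space"
  assumes "linear J" "linear P" "open S" "smooth_on f S"
  shows "smooth_on (\<lambda>y. P (f (a + J y))) {y. a + J y \<in> S}"
proof -
  have cont: "continuous_on A (\<lambda>y. a + J y)" for A
    using linear_continuous_on[of J A] assms(1)
    by (intro continuous_intros) (simp add: linear_linear)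
  have op: "open {y. a + J y \<in> S}"
    using open_vimage[OF \<open>open S\<close> cont[of UNIV]] by (simp add: vimage_def)
  have "Ck_on k f S \<Longrightarrow> Ck_on k (\<lambda>y. P (f (a + J y))) {y. a + J y \<in> S}" for k
  proof (induction k arbitrary: f)
    case 0
    have "continuous_on {y. a + J y \<in> S} (\<lambda>y. f (a + J y))"
      by (rule continuous_on_compose2[OF _ cont]) (use 0 in auto)
    then have "continuous_on {y. a + J y \<in> S} (\<lambda>y. P (f (a + J y)))"
      using assms(2) by (intro bounded_linear.continuous_on[of P]) (simp add: linear_linear)
    then show ?case by simp
  next
    case (Suc k)
    have der: "((\<lambda>y. P (f (a + J y))) has_derivative
           (\<lambda>v. P (frechet_derivative f (at (a + J y)) (J v)))) (at y)" if "a + J y \<in> S" for y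
      using frechet_derivative_affine_compose[OF assms(1,2)] Suc.prems that by simp
    have "Ck_on k (\<lambda>y. frechet_derivative (\<lambda>y. P (f (a + J y))) (at y) v) {y. a + J y \<in> S}" for v
    proof (rule Ck_on_cong[OF op])
      show "Ck_on k (\<lambda>y. P (frechet_derivative f (at (a + J y)) (J v))) {y. a + J y \<in> S}"
        using Suc.prems by (intro Suc.IH) simp
    qed (use frechet_derivative_at[OF der] in \<open>auto simp: fun_eq_iff\<close>)
    then show ?case using der by (auto simp: differentiable_def)
  qed
  then show ?thesis using assms(4) by (simp add: smooth_on_def)
qed

text \<open>\<open>\<sigma> x\<close> is the signed distance along \<open>e\<close> from
  \<open>x\<close> to the zero set of \<open>g\<close>. Defining it on a full ball, rather than on a
  complement of \<open>e\<close>, avoids coordinates and gives a new equation of the zero set with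
  explicit gradient.\<close>

lemma implicit_function_along:
  fixes g :: "'a::euclidean_space \<Rightarrow> real"
  assumes "open U" "smooth_on g U" "p \<in> U" "g p = 0" "norm e = 1" "frechet_derivative g (at p) e \<noteq> 0"
  obtains r \<sigma> where "r > 0" "ball p r \<subseteq> U"
    "\<And>x. x \<in> ball p r \<Longrightarrow> x + \<sigma> x *\<^sub>R e \<in> U \<and> g (x + \<sigma> x *\<^sub>R e) = 0 \<and>
        frechet_derivative g (at (x + \<sigma> x *\<^sub>R e)) e \<noteq> 0 \<and> (g x = 0 \<longleftrightarrow> \<sigma> x = 0)"
    "\<And>x. x \<in> ball p r \<Longrightarrow> (\<sigma> has_derivative
        (\<lambda>v. - frechet_derivative g (at (x + \<sigma> x *\<^sub>R e)) v /
             frechet_derivative g (at (x + \<sigma> x *\<^sub>R e)) e)) (at x)"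
proof -
  define D where "D x = frechet_derivative g (at x)" for x
  define U1 where "U1 = U \<inter> (\<lambda>x. D x e) -` (- {0})"
  have contD: "continuous_on U (\<lambda>x. D x v)" for v
    unfolding D_def using assms(2) smooth_on_frechet_derivative smooth_on_imp_continuous_on by blast
  have U1: "open U1" "U1 \<subseteq> U" "p \<in> U1"
    using continuous_open_preimage[OF contD \<open>open U\<close>, of "- {0}" e] assms
    by (auto simp: U1_def D_def)
  have D: "(g has_derivative D x) (at x)" if "x \<in> U" for x
    using smooth_on_has_derivative[OF assms(2) that] by (simp add: D_def)
  have ee: "e \<bullet> e = 1" using assms(5) by (simp add: dot_square_norm)
  \<comment> \<open>\<open>\<Phi>\<close> replaces the component along \<open>e\<close> by the value
    of \<open>g\<close>, so it straightens the zero set into the hyperplane orthogonal to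
    \<open>e\<close>.\<close>
  define \<Phi> where "\<Phi> x = x + (g x - x \<bullet> e) *\<^sub>R e" for x
  define \<Phi>' where "\<Phi>' x = Blinfun (\<lambda>v. v + (D x v - v \<bullet> e) *\<^sub>R e)" for x
  have blD: "bounded_linear (D x)" if "x \<in> U" for x
    using D[OF that] by (rule has_derivative_bounded_linear)
  have \<Phi>'_apply: "blinfun_apply (\<Phi>' x) = (\<lambda>v. v + (D x v - v \<bullet> e) *\<^sub>R e)" if "x \<in> U" for x
    unfolding \<Phi>'_def
    by (rule bounded_linear_Blinfun_apply)
       (intro bounded_linear_add bounded_linear_ident bounded_linear_scaleR_const bounded_linear_sub
          blD[OF that] bounded_linear_inner_left)
  \<comment> \<open>Obtained by solving \<open>\<Phi>' p v = w\<close>: pairing with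
    \<open>e\<close> gives \<open>D p v = w \<bullet> e\<close>, and applying \<open>D p\<close>
    then yields the component to be added along \<open>e\<close>.\<close>
  define inv\<Phi> where "inv\<Phi> = Blinfun (\<lambda>w. w + ((w \<bullet> e - D p w) / D p e) *\<^sub>R e)"
  have inv_apply: "blinfun_apply inv\<Phi> = (\<lambda>w. w + ((w \<bullet> e - D p w) / D p e) *\<^sub>R e)"
    unfolding inv\<Phi>_def
    by (rule bounded_linear_Blinfun_apply)
       (intro bounded_linear_add bounded_linear_ident bounded_linear_scaleR_const bounded_linear_divide
          bounded_linear_compose[OF bounded_linear_divide]
          bounded_linear_sub blD bounded_linear_inner_left \<open>p \<in> U\<close>)
  have der\<Phi>: "(\<Phi> has_derivative blinfun_apply (\<Phi>' x)) (at x)" if "x \<in> U1" for x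
    using that U1 unfolding \<Phi>_def
    by (subst \<Phi>'_apply) (auto intro!: derivative_eq_intros D)
  have cont\<Phi>: "continuous_on U1 \<Phi>'"
  proof (rule continuous_on_blinfun_componentwise)
    fix i :: 'a assume "i \<in> Basis"
    have "continuous_on U1 (\<lambda>x. i + (D x i - i \<bullet> e) *\<^sub>R e)"
      using continuous_on_subset[OF contD U1(2)] by (intro continuous_intros)
    then show "continuous_on U1 (\<lambda>x. blinfun_apply (\<Phi>' x) i)"
      using U1 \<Phi>'_apply by (subst continuous_on_cong[OF refl]) auto
  qed
  have inv: "inv\<Phi> o\<^sub>L \<Phi>' p = id_blinfun"
  proof (rule blinfun_eqI)
    fix v
    have "linear (D p)" using blD[OF \<open>p \<in> U\<close>] bounded_linear.linear by blast
    then have "D p (v + s *\<^sub>R e) = D p v + s * D p e" for s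
      by (simp add: linear_add linear_scale)
    then show "blinfun_apply (inv\<Phi> o\<^sub>L \<Phi>' p) v = blinfun_apply id_blinfun v"
      using assms(6) \<Phi>'_apply[OF \<open>p \<in> U\<close>] ee
      by (simp add: inv_apply inner_left_distrib D_def scaleR_left_distrib[symmetric])
  qed
  obtain U' V G G' where G: "open U'" "U' \<subseteq> U1" "p \<in> U'" "open V" "\<Phi> p \<in> V"
      "homeomorphism U' V \<Phi> G" "\<And>y. y \<in> V \<Longrightarrow> (G has_derivative (G' y)) (at y)"
    by (rule inverse_function_theorem[OF U1(1) der\<Phi> cont\<Phi> U1(3) inv]) blast+
  \<comment> \<open>Orthogonal projection along \<open>e\<close>. For \<open>x\<close> near
    \<open>p\<close>, \<open>G (Q x)\<close> will be the foot point: a zero of \<open>g\<close> on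
    the line through \<open>x\<close> in direction \<open>e\<close>.\<close>
  define Q where "Q x = x - (x \<bullet> e) *\<^sub>R e" for x
  have Q: "(Q has_derivative Q) (at x)" for x
    unfolding Q_def by (auto intro!: derivative_eq_intros)
  have "continuous_on UNIV Q" unfolding Q_def by (intro continuous_intros)
  then have "open (U' \<inter> Q -` V)"
    using G by (simp add: open_Int open_vimage)
  moreover have "p \<in> U' \<inter> Q -` V"
    using G assms(4) by (simp add: \<Phi>_def Q_def)
  ultimately obtain r where r: "r > 0" "ball p r \<subseteq> U' \<inter> Q -` V"
    by (meson openE)
  define \<sigma> where "\<sigma> x = G (Q x) \<bullet> e - x \<bullet> e" for x
  have lift: "G (Q x) = x + \<sigma> x *\<^sub>R e \<and> G (Q x) \<in> U1 \<and> g (G (Q x)) = 0" if "x \<in> ball p r" for x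
  proof -
    have *: "G (Q x) \<in> U'" "\<Phi> (G (Q x)) = Q x"
      using that r G(6) by (auto simp: homeomorphism_def)
    then have "\<Phi> (G (Q x)) \<bullet> e = Q x \<bullet> e" by simp
    then have "g (G (Q x)) = 0" by (simp add: \<Phi>_def Q_def inner_left_distrib inner_diff_left ee)
    then show ?thesis using * G by (auto simp: \<Phi>_def Q_def \<sigma>_def algebra_simps)
  qed
  have zero: "g x = 0 \<longleftrightarrow> \<sigma> x = 0" if "x \<in> ball p r" for x
  proof
    assume "g x = 0"
    then have "\<Phi> x = Q x" by (simp add: \<Phi>_def Q_def)
    moreover have "G (\<Phi> x) = x" using that r G(6) by (auto simp: homeomorphism_def)
    ultimately show "\<sigma> x = 0" by (simp add: \<sigma>_def)
  qed (use lift[OF that] in auto)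
  have der: "(\<sigma> has_derivative (\<lambda>v. - D (x + \<sigma> x *\<^sub>R e) v / D (x + \<sigma> x *\<^sub>R e) e)) (at x)"
    if x: "x \<in> ball p r" for x
  proof -
    define y where "y = x + \<sigma> x *\<^sub>R e"
    have "Q x \<in> V" using x r by auto
    have GQ: "((\<lambda>x. G (Q x)) has_derivative (\<lambda>v. G' (Q x) (Q v))) (at x)"
      by (rule has_derivative_compose[OF Q G(7)[OF \<open>Q x \<in> V\<close>]])
    define \<sigma>' where "\<sigma>' v = G' (Q x) (Q v) \<bullet> e - v \<bullet> e" for v
    have \<sigma>': "(\<sigma> has_derivative \<sigma>') (at x)"
      unfolding \<sigma>_def \<sigma>'_def
      by (intro has_derivative_diff has_derivative_inner_left GQ has_derivative_ident)
    have y: "y \<in> U" "D y e \<noteq> 0" using lift[OF x] U1 by (auto simp: y_def U1_def)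
    have 1: "((\<lambda>x. x + \<sigma> x *\<^sub>R e) has_derivative (\<lambda>v. v + \<sigma>' v *\<^sub>R e)) (at x)"
      by (intro has_derivative_add has_derivative_ident has_derivative_scaleR_left \<sigma>')
    \<comment> \<open>Implicit differentiation: \<open>\<sigma>\<close> is differentiable because
      \<open>G\<close> is, and the vanishing of \<open>g\<close> at all foot points determines
      \<open>\<sigma>'\<close>.\<close>
    have "((\<lambda>x. g (x + \<sigma> x *\<^sub>R e)) has_derivative (\<lambda>v. D y (v + \<sigma>' v *\<^sub>R e))) (at x)"
      using has_derivative_compose[OF 1, of g "D y"] D[OF y(1)] by (simp add: y_def)
    moreover have "((\<lambda>x. g (x + \<sigma> x *\<^sub>R e)) has_derivative (\<lambda>v. 0)) (at x)"
      by (rule has_derivative_transform_within_open[OF has_derivative_const[of 0] open_ball x])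
         (use lift in force)
    ultimately have eq: "(\<lambda>v. D y (v + \<sigma>' v *\<^sub>R e)) = (\<lambda>v. 0)"
      by (rule has_derivative_unique)
    have "\<sigma>' v = - D y v / D y e" for v
    proof -
      have "linear (D y)" using blD[OF y(1)] bounded_linear.linear by blast
      then have "D y v + \<sigma>' v * D y e = 0"
        using fun_cong[OF eq, of v] by (simp add: linear_add linear_scale)
      then show ?thesis using y by (simp add: field_simps)
    qed
    then have "\<sigma>' = (\<lambda>v. - D y v / D y e)" by blast
    then show ?thesis using \<sigma>' by (simp add: y_def)
  qed
  show thesis
  proof (rule that[of r \<sigma>])
    show "ball p r \<subseteq> U" using r G U1 by auto
    show "x + \<sigma> x *\<^sub>R e \<in> U \<and> g (x + \<sigma> x *\<^sub>R e) = 0 \<and>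
        frechet_derivative g (at (x + \<sigma> x *\<^sub>R e)) e \<noteq> 0 \<and> (g x = 0 \<longleftrightarrow> \<sigma> x = 0)"
      if "x \<in> ball p r" for x
    proof -
      have "x + \<sigma> x *\<^sub>R e \<in> U1" "g (x + \<sigma> x *\<^sub>R e) = 0" using lift[OF that] by auto
      then show ?thesis using zero[OF that] by (auto simp: U1_def D_def)
    qed
  qed (use r der in \<open>auto simp only: D_def\<close>)
qed

section \<open>Tangent spaces, helices and mean curvature\<close>

text \<open>The local data behind \<open>hypersurface\<close>, named so that the neighbourhood can
  be shrunk while the equation is kept.\<close>

definition local_equation :: "'a::euclidean_space set \<Rightarrow> 'a set \<Rightarrow> ('a \<Rightarrow> real) \<Rightarrow> bool" where
  "local_equation M U g \<longleftrightarrow> open U \<and> smooth_on g U \<and> M \<inter> U = {x \<in> U. g x = 0} \<and>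
     (\<forall>x\<in>M \<inter> U. \<exists>v. frechet_derivative g (at x) v \<noteq> 0)"

lemma hypersurface_local_equation:
  "hypersurface M \<longleftrightarrow> (\<forall>p\<in>M. \<exists>U g. p \<in> U \<and> local_equation M U g)"
  unfolding hypersurface_def local_equation_def by (simp only: conj_ac)

lemma local_equation_subset:
  assumes "local_equation M U g" "open V" "V \<subseteq> U"
  shows "local_equation M V g"
proof -
  have "smooth_on g V" using assms smooth_on_subset by (auto simp: local_equation_def)
  moreover have "M \<inter> V = {x \<in> V. g x = 0}" using assms by (auto simp: local_equation_def)
  moreover have "\<forall>x\<in>M \<inter> V. \<exists>v. frechet_derivative g (at x) v \<noteq> 0"
    using assms by (auto simp: local_equation_def)
  ultimately show ?thesis using assms by (simp add: local_equation_def)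
qed

lemma linear_frechet_derivative_smooth: "smooth_on f U \<Longrightarrow> x \<in> U \<Longrightarrow> linear (frechet_derivative f (at x))"
  using smooth_on_has_derivative has_derivative_linear by blast

text \<open>Chain rule along a curve in \<open>M\<close>. It is the source of every infinitesimal
  identity below: \<open>f\<close> is successively an equation of \<open>M\<close>, the squared
  length of a normal, its component along the axis, and a linear form.\<close>

lemma tangent_space_derivative:
  assumes "v \<in> tangent_space M q" "(f has_derivative f') (at q)" "open U" "q \<in> U"
    and "\<And>x. x \<in> M \<inter> U \<Longrightarrow> f x = c"
  shows "f' v = 0"
proof -
  obtain \<gamma> where \<gamma>: "\<gamma> 0 = q" "\<forall>\<^sub>F t in nhds 0. \<gamma> t \<in> M" "(\<gamma> has_vector_derivative v) (at 0)"
    using assms(1) by (auto simp: tangent_space_def)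
  have "isCont \<gamma> 0" using \<gamma>(3) has_vector_derivative_continuous by blast
  then have "\<forall>\<^sub>F t in nhds 0. \<gamma> t \<in> U"
    using assms(3,4) \<gamma>(1) by (intro topological_tendstoD) (auto simp: isCont_def tendsto_at_iff_tendsto_nhds)
  with \<gamma>(2) have ev: "\<forall>\<^sub>F t in nhds 0. f (\<gamma> t) = c"
    by eventually_elim (use assms(5) in auto)
  then obtain S where S: "open S" "0 \<in> S" "\<And>t. t \<in> S \<Longrightarrow> f (\<gamma> t) = c"
    unfolding eventually_nhds by blast
  have "((\<lambda>t. f (\<gamma> t)) has_derivative (\<lambda>t. f' (t *\<^sub>R v))) (at 0)"
    using has_derivative_compose[of \<gamma> "\<lambda>t. t *\<^sub>R v" 0 UNIV f f'] \<gamma> assms(2)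
    by (simp add: has_vector_derivative_def)
  moreover have "((\<lambda>t. f (\<gamma> t)) has_derivative (\<lambda>t. 0)) (at 0)"
    by (rule has_derivative_transform_within_open[OF has_derivative_const[of c] S(1,2)]) (simp add: S(3))
  ultimately have "(\<lambda>t. f' (t *\<^sub>R v)) = (\<lambda>t. 0)"
    by (rule has_derivative_unique)
  from fun_cong[OF this, of 1] show ?thesis by simp
qed

text \<open>One inclusion is the chain rule. For the other, a line with velocity in the kernel is
  pushed back to \<open>M\<close> along a transversal direction.\<close>

lemma tangent_space_level_set:
  assumes "local_equation M U g" "q \<in> M" "q \<in> U"
  shows "tangent_space M q = {v. frechet_derivative g (at q) v = 0}"
proof (intro set_eqI iffI; unfold mem_Collect_eq)
  have U: "open U" "smooth_on g U" "M \<inter> U = {x \<in> U. g x = 0}"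
    using assms(1) by (auto simp: local_equation_def)
  have gq: "g q = 0" using U assms by blast
  {
    fix v assume "v \<in> tangent_space M q"
    then show "frechet_derivative g (at q) v = 0"
      by (rule tangent_space_derivative[OF _ smooth_on_has_derivative[OF U(2)] U(1)]) (use assms U in auto)
  next
    fix v assume v: "frechet_derivative g (at q) v = 0"
    obtain e' where "frechet_derivative g (at q) e' \<noteq> 0"
      using assms by (auto simp: local_equation_def)
    moreover have lin: "linear (frechet_derivative g (at q))"
      using linear_frechet_derivative_smooth U(2) assms(3) by blast
    moreover from calculation have "e' \<noteq> 0" by (auto simp: linear_0)
    ultimately have e: "norm (e' /\<^sub>R norm e') = 1" "frechet_derivative g (at q) (e' /\<^sub>R norm e') \<noteq> 0"
      by (auto simp: linear_scale[OF lin])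
    define e where "e = e' /\<^sub>R norm e'"
    obtain r \<sigma> where r: "r > 0" "ball q r \<subseteq> U"
      and lift: "\<And>x. x \<in> ball q r \<Longrightarrow> x + \<sigma> x *\<^sub>R e \<in> U \<and> g (x + \<sigma> x *\<^sub>R e) = 0 \<and>
        frechet_derivative g (at (x + \<sigma> x *\<^sub>R e)) e \<noteq> 0 \<and> (g x = 0 \<longleftrightarrow> \<sigma> x = 0)"
      and der: "\<And>x. x \<in> ball q r \<Longrightarrow> (\<sigma> has_derivative
        (\<lambda>v. - frechet_derivative g (at (x + \<sigma> x *\<^sub>R e)) v /
             frechet_derivative g (at (x + \<sigma> x *\<^sub>R e)) e)) (at x)"
      by (rule implicit_function_along[OF U(1,2) assms(3) gq e[folded e_def]]) blast+
    have "\<sigma> q = 0" using lift[of q] r gq by simp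
    \<comment> \<open>The correction along \<open>e\<close> has derivative zero at \<open>0\<close>,
      because the derivative of \<open>\<sigma>\<close> at \<open>q\<close> is a multiple of that of
      \<open>g\<close>, which kills \<open>v\<close>; the velocity therefore remains
      \<open>v\<close>.\<close>
    define \<gamma> where "\<gamma> t = (q + t *\<^sub>R v) + \<sigma> (q + t *\<^sub>R v) *\<^sub>R e" for t
    have line: "((\<lambda>t. q + t *\<^sub>R v) has_derivative (\<lambda>t. t *\<^sub>R v)) (at 0)"
      by (auto intro!: derivative_eq_intros)
    have "((\<lambda>t. \<sigma> (q + t *\<^sub>R v)) has_derivative (\<lambda>t. 0)) (at 0)"
      using has_derivative_compose[OF line, of \<sigma>] der[of q] r v \<open>\<sigma> q = 0\<close>
      by (force simp: linear_scale[OF lin])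
    then have "(\<gamma> has_derivative (\<lambda>t. t *\<^sub>R v + 0 *\<^sub>R e)) (at 0)"
      unfolding \<gamma>_def by (intro has_derivative_add line has_derivative_scaleR_left)
    then have "(\<gamma> has_vector_derivative v) (at 0)" by (simp add: has_vector_derivative_def)
    moreover have "\<gamma> 0 = q" by (simp add: \<gamma>_def \<open>\<sigma> q = 0\<close>)
    moreover have "\<forall>\<^sub>F t in nhds 0. \<gamma> t \<in> M"
    proof -
      have "open ((\<lambda>t. q + t *\<^sub>R v) -` ball q r)"
        by (intro open_vimage open_ball continuous_intros)
      then have "\<forall>\<^sub>F t in nhds 0. q + t *\<^sub>R v \<in> ball q r"
        unfolding eventually_nhds using r(1) by (intro exI[of _ "(\<lambda>t. q + t *\<^sub>R v) -` ball q r"]) auto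
      then show ?thesis
      proof eventually_elim
        case (elim t)
        then have "\<gamma> t \<in> {x \<in> U. g x = 0}" using lift[OF elim] by (simp add: \<gamma>_def)
        then show ?case using U(3) by blast
      qed
    qed
    ultimately show "v \<in> tangent_space M q" by (auto simp: tangent_space_def)
  }
qed

lemma subspace_tangent_space:
  assumes "local_equation M U g" "q \<in> M" "q \<in> U"
  shows "subspace (tangent_space M q)"
proof -
  have "linear (frechet_derivative g (at q))"
    using assms linear_frechet_derivative_smooth by (auto simp: local_equation_def)
  then show ?thesis
    using linear_subspace_kernel tangent_space_level_set[OF assms] by simp
qed

text \<open>The tangent space is the kernel of a single linear form, and \<open>n\<close> lies
  outside it. Hence any vector orthogonal to \<open>n\<close> can be compared with its tangent part
  along \<open>n\<close>.\<close>

lemma tangent_space_eq_normal_complement: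
  assumes "local_equation M U g" "q \<in> M" "q \<in> U" "norm n = 1" "\<forall>v\<in>tangent_space M q. n \<bullet> v = 0"
  shows "tangent_space M q = {v. n \<bullet> v = 0}"
proof -
  let ?D = "frechet_derivative g (at q)"
  have lin: "linear ?D"
    using assms linear_frechet_derivative_smooth by (auto simp: local_equation_def)
  have T: "tangent_space M q = {v. ?D v = 0}" using tangent_space_level_set assms by blast
  have nn: "n \<bullet> n = 1" using assms(4) by (simp add: dot_square_norm)
  have Dn: "?D n \<noteq> 0" using T assms(5) nn by force
  have "?D v = 0" if "n \<bullet> v = 0" for v
  proof -
    have "?D (v - (?D v / ?D n) *\<^sub>R n) = 0"
      using Dn by (simp add: linear_diff[OF lin] linear_scale[OF lin])
    then have "n \<bullet> (v - (?D v / ?D n) *\<^sub>R n) = 0" using T assms(5) by blast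
    then show ?thesis using that nn Dn by (simp add: inner_diff_right)
  qed
  then show ?thesis using T assms(5) by auto
qed

text \<open>Existence and uniqueness of the orthogonal projection, which give the definite
  description its meaning.\<close>

lemma tangential_component_eq:
  assumes T: "tangent_space M q = {v. n \<bullet> v = 0}" and n: "norm n = 1"
  shows "tangential_component M q d = d - (n \<bullet> d) *\<^sub>R n"
  unfolding tangential_component_def T
proof (rule the_equality)
  let ?w = "d - (n \<bullet> d) *\<^sub>R n"
  have w: "n \<bullet> ?w = 0" using n by (simp add: inner_diff_right dot_square_norm)
  then show "?w \<in> {v. n \<bullet> v = 0} \<and> (\<forall>v\<in>{v. n \<bullet> v = 0}. (d - ?w) \<bullet> v = 0)" by simp
  fix w' assume w': "w' \<in> {v. n \<bullet> v = 0} \<and> (\<forall>v\<in>{v. n \<bullet> v = 0}. (d - w') \<bullet> v = 0)"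
  then have "n \<bullet> (?w - w') = 0" using w by (simp only: inner_diff_right) simp
  then have "(d - w') \<bullet> (?w - w') = 0" "(d - ?w) \<bullet> (?w - w') = 0"
    using w' by auto
  then have "(?w - w') \<bullet> (?w - w') = 0" by (simp only: inner_diff_left)
  then show "w' = ?w" by (simp only: inner_eq_zero_iff right_minus_eq)
qed

text \<open>By Pythagoras the normal part of the unit axis has length
  \<open>\<bar>sin \<theta>\<bar>\<close>, and rescaling the axis does not affect the angle.
  Quantifying over all unit normals with an absolute value avoids choosing a sign.\<close>

lemma helix_normal_component:
  assumes M: "hypersurface M" and "helix M"
  obtains d K where "norm d = 1" "K \<ge> 0"
    "\<And>q n. q \<in> M \<Longrightarrow> norm n = 1 \<Longrightarrow> \<forall>v\<in>tangent_space M q. n \<bullet> v = 0 \<Longrightarrow> \<bar>n \<bullet> d\<bar> = K"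
proof -
  obtain d' \<theta> where d': "d' \<noteq> 0" "\<And>q. q \<in> M \<Longrightarrow> tangent_angle M q d' = \<theta>"
    using assms(2) by (auto simp: helix_def)
  define d where "d = d' /\<^sub>R norm d'"
  have d: "norm d = 1" "d' = norm d' *\<^sub>R d" using d' by (auto simp: d_def)
  have "\<bar>n \<bullet> d\<bar> = \<bar>sin \<theta>\<bar>" if q: "q \<in> M" and n: "norm n = 1" "\<forall>v\<in>tangent_space M q. n \<bullet> v = 0" for q n
  proof -
    obtain U g where "q \<in> U" "local_equation M U g"
      using M q by (auto simp: hypersurface_local_equation)
    then have T: "tangent_space M q = {v. n \<bullet> v = 0}"
      using tangent_space_eq_normal_complement q n by blast
    have nn: "n \<bullet> n = 1" "d \<bullet> d = 1" using n d by (simp_all add: dot_square_norm)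
    have tc: "tangential_component M q d = d - (n \<bullet> d) *\<^sub>R n" for d
      by (rule tangential_component_eq[OF T n(1)])
    have scale: "tangential_component M q d' = norm d' *\<^sub>R tangential_component M q d"
      unfolding tc d_def using d'(1) by (simp add: scaleR_diff_right)
    define x where "x = norm (tangential_component M q d)"
    have x2: "x\<^sup>2 = 1 - (n \<bullet> d)\<^sup>2"
      unfolding x_def tc power2_norm_eq_inner
      by (simp add: inner_diff_left inner_diff_right nn inner_commute[of d n] power2_eq_square)
    then have x: "0 \<le> x" "x \<le> 1" by (auto simp: x_def intro: power2_le_imp_le)
    \<comment> \<open>Since \<open>x\<close> lies between 0 and 1, \<open>arccos x\<close> is the
      only angle in the prescribed range with this cosine.\<close>
    have "tangent_angle M q d' = arccos x"
      unfolding tangent_angle_def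
    proof (rule the_equality)
      show "arccos x \<in> {0..pi / 2} \<and> norm (tangential_component M q d') = norm d' * cos (arccos x)"
        using x arccos_le_pi2[of x] by (simp add: scale x_def[symmetric] arccos_lbound)
      fix t assume t: "t \<in> {0..pi / 2} \<and> norm (tangential_component M q d') = norm d' * cos t"
      then have "cos t = x" using d'(1) by (simp add: scale x_def)
      then show "t = arccos x" using t arccos_cos[of t] by auto
    qed
    then have "cos \<theta> = x" using d'(2)[OF q] x by auto
    then have "(sin \<theta>)\<^sup>2 = (n \<bullet> d)\<^sup>2" using x2 by (simp add: sin_squared_eq)
    then have "sqrt ((sin \<theta>)\<^sup>2) = sqrt ((n \<bullet> d)\<^sup>2)" by simp
    then show ?thesis by (simp only: real_sqrt_abs)
  qed
  then show thesis by (rule that[OF d(1) abs_ge_zero])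
qed

text \<open>Each vector of one basis is expanded in the other and the sums are exchanged.
  \<open>A\<close> may leave \<open>V\<close>: the sum is the trace of \<open>A\<close> followed by
  orthogonal projection to \<open>V\<close>, as required for derivatives of an extended
  normal.\<close>

lemma trace_orthonormal_basis_independent:
  fixes A :: "'a::euclidean_space \<Rightarrow> 'a"
  assumes A: "linear A" and "orthonormal_basis B V" "orthonormal_basis C V"
  shows "(\<Sum>b\<in>B. A b \<bullet> b) = (\<Sum>c\<in>C. A c \<bullet> c)"
proof -
  have fin: "finite B" if "orthonormal_basis B V" for B :: "'a set"
    using that pairwise_orthogonal_imp_finite by (auto simp: orthonormal_basis_def)
  have exp: "(\<Sum>b\<in>B. (x \<bullet> b) *\<^sub>R b) = x" if "orthonormal_basis B V" "x \<in> V" for x and B :: "'a set"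
    using orthonormal_basis_expand[of B x] that fin[OF that(1)] by (auto simp: orthonormal_basis_def)
  have mem: "b \<in> V" if "orthonormal_basis B V" "b \<in> B" for b and B :: "'a set"
    using that span_base by (auto simp: orthonormal_basis_def)
  have "(\<Sum>b\<in>B. A b \<bullet> b) = (\<Sum>b\<in>B. \<Sum>c\<in>C. (b \<bullet> c) * (A b \<bullet> c))"
  proof (rule sum.cong[OF refl])
    fix b assume "b \<in> B"
    have "A b \<bullet> b = A b \<bullet> (\<Sum>c\<in>C. (b \<bullet> c) *\<^sub>R c)"
      using exp[OF assms(3) mem[OF assms(2) \<open>b \<in> B\<close>]] by simp
    then show "A b \<bullet> b = (\<Sum>c\<in>C. (b \<bullet> c) * (A b \<bullet> c))" by (simp add: inner_sum_right)
  qed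
  also have "\<dots> = (\<Sum>c\<in>C. \<Sum>b\<in>B. (b \<bullet> c) * (A b \<bullet> c))" by (rule sum.swap)
  also have "\<dots> = (\<Sum>c\<in>C. A c \<bullet> c)"
  proof (rule sum.cong[OF refl])
    fix c assume "c \<in> C"
    have "A c \<bullet> c = A (\<Sum>b\<in>B. (c \<bullet> b) *\<^sub>R b) \<bullet> c"
      using exp[OF assms(2) mem[OF assms(3) \<open>c \<in> C\<close>]] by simp
    then show "(\<Sum>b\<in>B. (b \<bullet> c) * (A b \<bullet> c)) = A c \<bullet> c"
      by (simp add: linear_sum[OF A] linear_scale[OF A] inner_sum_left inner_commute[of c])
  qed
  finally show ?thesis .
qed

text \<open>Removes the choice of basis from \<open>mean_curvature\<close>, so that a basis adapted
  to the geometry can be used.\<close>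

lemma mean_curvature_orthonormal_basis:
  fixes M :: "'a::euclidean_space set"
  assumes "linear (frechet_derivative \<nu> (at q))" "orthonormal_basis B (tangent_space M q)"
  shows "mean_curvature M \<nu> q = - (\<Sum>b\<in>B. frechet_derivative \<nu> (at q) b \<bullet> b) / (real DIM('a) - 1)"
proof -
  have "orthonormal_basis (SOME B. orthonormal_basis B (tangent_space M q)) (tangent_space M q)"
    using assms(2) by (rule someI)
  from trace_orthonormal_basis_independent[OF assms(1) this assms(2)]
  show ?thesis by (simp add: mean_curvature_def shape_operator_def sum_negf)
qed

lemma orthonormal_basis_exists:
  assumes "subspace V"
  obtains B where "orthonormal_basis B V"
proof -
  obtain B where B: "pairwise orthogonal B" "\<And>x. x \<in> B \<Longrightarrow> norm x = 1" "span B = V"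
    by (rule orthonormal_basis_subspace[OF assms]) blast
  show thesis by (rule that[of B]) (use B in \<open>simp add: orthonormal_basis_def\<close>)
qed

section \<open>Normals with a nonzero component along the axis\<close>

text \<open>The length of \<open>\<nu>\<close> is 1 only on \<open>M\<close>, so differentiating it
  gives information in tangent directions only.\<close>

lemma unit_normal_field_derivative_tangent:
  assumes "unit_normal_field M U \<nu>" "q \<in> M" "q \<in> U" "v \<in> tangent_space M q"
  shows "frechet_derivative \<nu> (at q) v \<bullet> \<nu> q = 0"
proof -
  have U: "open U" "smooth_on \<nu> U" and n: "\<And>x. x \<in> M \<inter> U \<Longrightarrow> norm (\<nu> x) = 1"
    using assms(1) by (auto simp: unit_normal_field_def)
  have "((\<lambda>x. \<nu> x \<bullet> \<nu> x) has_derivative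
      (\<lambda>v. \<nu> q \<bullet> frechet_derivative \<nu> (at q) v + frechet_derivative \<nu> (at q) v \<bullet> \<nu> q)) (at q)"
    by (intro has_derivative_inner smooth_on_has_derivative[OF U(2) assms(3)])
  from tangent_space_derivative[OF assms(4) this U(1) assms(3), of 1] n
  show ?thesis by (simp add: dot_square_norm inner_commute)
qed

lemma orthonormal_basis_Basis: "orthonormal_basis Basis UNIV"
  by (auto simp: orthonormal_basis_def pairwise_def orthogonal_def inner_Basis)

lemma orthonormal_basis_insert_normal:
  assumes "orthonormal_basis B {v. n \<bullet> v = 0}" "norm n = 1"
  shows "orthonormal_basis (insert n B) UNIV"
proof -
  have B: "\<And>b. b \<in> B \<Longrightarrow> n \<bullet> b = 0"
    using assms(1) span_base by (force simp: orthonormal_basis_def)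
  have "v \<in> span (insert n B)" for v
  proof -
    have "v - (n \<bullet> v) *\<^sub>R n \<in> span B"
      using assms by (simp add: orthonormal_basis_def inner_diff_right dot_square_norm)
    then have "v - (n \<bullet> v) *\<^sub>R n \<in> span (insert n B)"
      using span_mono[of B "insert n B"] by blast
    moreover have "(n \<bullet> v) *\<^sub>R n \<in> span (insert n B)"
      by (simp add: span_base span_scale)
    ultimately show ?thesis using span_add by fastforce
  qed
  then show ?thesis
    using assms B
    by (auto simp: orthonormal_basis_def pairwise_insert orthogonal_def inner_commute)
qed

text \<open>The map \<open>v \<mapsto> v - (n \<bullet> v / c) d\<close> projects onto the tangent space along \<open>d\<close>, so composing with it
  extends an endomorphism of the tangent space to the whole space without changing its trace.\<close>

lemma trace_oblique_projection:
  fixes A :: "'a::euclidean_space \<Rightarrow> 'a"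
  assumes A: "linear A" and B: "orthonormal_basis B {v. n \<bullet> v = 0}" and n: "norm n = 1"
    and tangent: "\<And>v. n \<bullet> v = 0 \<Longrightarrow> A v \<bullet> n = 0" and d: "n \<bullet> d = c" "c \<noteq> 0"
  shows "(\<Sum>b\<in>Basis. A (b - (n \<bullet> b / c) *\<^sub>R d) \<bullet> b) = (\<Sum>b\<in>B. A b \<bullet> b)"
proof -
  let ?f = "\<lambda>v. A (v - (n \<bullet> v / c) *\<^sub>R d)"
  have "linear (\<lambda>v. v - (n \<bullet> v / c) *\<^sub>R d)"
    by (rule linearI) (auto simp: inner_right_distrib add_divide_distrib algebra_simps)
  then have lin: "linear ?f" using linear_compose[OF _ A] by (simp add: o_def)
  have nB: "n \<bullet> b = 0" if "b \<in> B" for b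
    using B that span_base by (force simp: orthonormal_basis_def)
  have nn: "n \<bullet> n = 1" using n by (simp add: dot_square_norm)
  have "n \<notin> B" using nB nn by force
  have "finite B" using B pairwise_orthogonal_imp_finite by (auto simp: orthonormal_basis_def)
  have "(\<Sum>b\<in>Basis. ?f b \<bullet> b) = (\<Sum>b\<in>insert n B. ?f b \<bullet> b)"
    by (rule trace_orthonormal_basis_independent[OF lin orthonormal_basis_Basis
          orthonormal_basis_insert_normal[OF B n]])
  also have "\<dots> = ?f n \<bullet> n + (\<Sum>b\<in>B. A b \<bullet> b)"
    using \<open>n \<notin> B\<close> \<open>finite B\<close> nB by simp
  \<comment> \<open>The projection sends \<open>n\<close> to \<open>n - d / c\<close>, which is
    orthogonal to \<open>n\<close>, so \<open>tangent\<close> kills the additional diagonal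
    entry.\<close>
  also have "?f n \<bullet> n = 0"
    using d by (intro tangent) (simp add: inner_diff_right nn)
  finally show ?thesis by simp
qed

text \<open>The signed height \<open>\<sigma>\<close> over \<open>M\<close> along \<open>d\<close>
  has gradient \<open>- N / c\<close>, where \<open>N\<close> is the normal at the foot point. This
  supplies the symmetry needed in Bochner's argument; once \<open>N\<close> is constant,
  \<open>\<sigma>\<close> is affine, and its zero set is \<open>M\<close>.\<close>

lemma locally_hyperplane:
  fixes M :: "'a::euclidean_space set"
  assumes M: "hypersurface M" and p: "p \<in> M" and dim: "2 \<le> DIM('a)"
    and K: "K \<noteq> 0"
    and comp: "\<And>q n. q \<in> M \<Longrightarrow> norm n = 1 \<Longrightarrow> \<forall>v\<in>tangent_space M q. n \<bullet> v = 0 \<Longrightarrow> \<bar>n \<bullet> d\<bar> = K"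
    and V: "p \<in> V" "unit_normal_field M V \<nu>" "\<And>q. q \<in> M \<inter> V \<Longrightarrow> mean_curvature M \<nu> q = H"
  shows "\<exists>n r. norm n = 1 \<and> r > 0 \<and> M \<inter> ball p r = {x \<in> ball p r. n \<bullet> (x - p) = 0}"
proof -
  obtain U0 g where U0: "p \<in> U0" "local_equation M U0 g"
    using M p by (auto simp: hypersurface_local_equation)
  have \<nu>: "open V" "smooth_on \<nu> V"
      "\<And>q. q \<in> M \<inter> V \<Longrightarrow> norm (\<nu> q) = 1 \<and> (\<forall>v\<in>tangent_space M q. \<nu> q \<bullet> v = 0)"
    using V(2) by (auto simp: unit_normal_field_def)
  define c where "c = \<nu> p \<bullet> d"
  have c: "\<bar>c\<bar> = K" using comp \<nu>(3) p V(1) by (simp add: c_def)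
  with K have c0: "c \<noteq> 0" by auto
  \<comment> \<open>On this neighbourhood \<open>\<nu> \<bullet> d\<close> keeps the sign of
    \<open>c\<close>, which upgrades constancy of the absolute value to
    \<open>\<nu> \<bullet> d = c\<close> on \<open>M\<close>.\<close>
  define U where "U = U0 \<inter> (V \<inter> (\<lambda>x. (\<nu> x \<bullet> d) * c) -` {0<..})"
  have "open (V \<inter> (\<lambda>x. (\<nu> x \<bullet> d) * c) -` {0<..})"
    by (rule continuous_open_preimage)
       (auto intro!: continuous_intros \<nu>(1) smooth_on_imp_continuous_on[OF \<nu>(2)])
  then have "open U" using U0(2) by (auto simp: U_def local_equation_def)
  have pU: "p \<in> U" using U0 V c0 by (simp add: U_def c_def[symmetric] flip: power2_eq_square)
  have UV: "U \<subseteq> V" by (auto simp: U_def)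
  have LE: "local_equation M U g"
    using local_equation_subset[OF U0(2) \<open>open U\<close>] by (auto simp: U_def)
  have g: "smooth_on g U" "M \<inter> U = {x \<in> U. g x = 0}" using LE by (auto simp: local_equation_def)
  have \<nu>d: "\<nu> q \<bullet> d = c" if "q \<in> M \<inter> U" for q
  proof -
    have "\<bar>\<nu> q \<bullet> d\<bar> = \<bar>c\<bar>" using comp[of q "\<nu> q"] \<nu>(3)[of q] that c UV by auto
    moreover have "(\<nu> q \<bullet> d) * c > 0" using that by (auto simp: U_def)
    ultimately show ?thesis by (auto simp: abs_eq_iff zero_less_mult_iff)
  qed
  have n1: "norm (\<nu> q) = 1" and T: "tangent_space M q = {v. \<nu> q \<bullet> v = 0}" if "q \<in> M \<inter> U" for q
    using tangent_space_eq_normal_complement[OF LE, of q "\<nu> q"] \<nu>(3)[of q] that UV by auto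
  define d0 where "d0 = d /\<^sub>R norm d"
  have d_nz: "d \<noteq> 0" using c0 by (auto simp: c_def)
  define D where "D q = frechet_derivative g (at q)" for q
  \<comment> \<open>Projecting \<open>v\<close> along \<open>d\<close> into the tangent space shows
    that the derivative of \<open>g\<close> is a multiple of the pairing with
    \<open>\<nu>\<close>.\<close>
  have D_eq: "D q v = (\<nu> q \<bullet> v / c) * D q d" if q: "q \<in> M \<inter> U" for q v
  proof -
    have "\<nu> q \<bullet> (v - (\<nu> q \<bullet> v / c) *\<^sub>R d) = 0"
      using \<nu>d[OF q] c0 by (simp add: inner_diff_right)
    then have "D q (v - (\<nu> q \<bullet> v / c) *\<^sub>R d) = 0"
      using T[OF q] tangent_space_level_set[OF LE, of q] q by (auto simp: D_def)
    moreover have "linear (D q)" using linear_frechet_derivative_smooth[OF g(1)] q by (auto simp: D_def)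
    ultimately show ?thesis by (simp add: linear_diff linear_scale)
  qed
  have Dd: "D q d \<noteq> 0" if q: "q \<in> M \<inter> U" for q
  proof
    assume "D q d = 0"
    then have "D q v = 0" for v using D_eq[OF q, of v] by simp
    then show False using LE q by (auto simp: local_equation_def D_def)
  qed
  have linD: "linear (D q)" if "q \<in> U" for q
    using linear_frechet_derivative_smooth[OF g(1) that] by (simp add: D_def)
  have "norm d0 = 1" using d_nz by (simp add: d0_def)
  have "D p d0 \<noteq> 0" using Dd[of p] p pU d_nz linD[OF pU] by (simp add: d0_def linear_scale)
  have gp: "g p = 0" using g p pU by blast
  obtain r \<sigma>0 where r: "r > 0" "ball p r \<subseteq> U"
    and lift0: "\<And>x. x \<in> ball p r \<Longrightarrow> x + \<sigma>0 x *\<^sub>R d0 \<in> U \<and> g (x + \<sigma>0 x *\<^sub>R d0) = 0 \<and>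
        frechet_derivative g (at (x + \<sigma>0 x *\<^sub>R d0)) d0 \<noteq> 0 \<and> (g x = 0 \<longleftrightarrow> \<sigma>0 x = 0)"
    and der0: "\<And>x. x \<in> ball p r \<Longrightarrow> (\<sigma>0 has_derivative
        (\<lambda>v. - frechet_derivative g (at (x + \<sigma>0 x *\<^sub>R d0)) v /
             frechet_derivative g (at (x + \<sigma>0 x *\<^sub>R d0)) d0)) (at x)"
    by (rule implicit_function_along[OF \<open>open U\<close> g(1) pU gp \<open>norm d0 = 1\<close> \<open>D p d0 \<noteq> 0\<close>[unfolded D_def]]) blast+
  \<comment> \<open>The implicit function was taken for the normalized direction \<open>d0\<close>;
    dividing by \<open>norm d\<close> measures displacement in multiples of
    \<open>d\<close>.\<close>
  define \<sigma> where "\<sigma> x = \<sigma>0 x / norm d" for x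
  define foot where "foot x = x + \<sigma> x *\<^sub>R d" for x
  define N where "N x = \<nu> (foot x)" for x
  have foot0: "foot x = x + \<sigma>0 x *\<^sub>R d0" for x by (simp add: foot_def \<sigma>_def d0_def field_simps)
  have foot: "foot x \<in> M \<inter> U" if "x \<in> ball p r" for x
    using lift0[OF that] g(2) by (auto simp: foot0)
  have g0: "g x = 0 \<longleftrightarrow> \<sigma> x = 0" if "x \<in> ball p r" for x
    using lift0[OF that] d_nz by (simp add: \<sigma>_def)
  have der\<sigma>: "(\<sigma> has_derivative (\<lambda>v. - (N x \<bullet> v) / c)) (at x)" if x: "x \<in> ball p r" for x
  proof -
    have eq: "- D (foot x) v / D (foot x) d0 / norm d = - (N x \<bullet> v) / c" for v
      using D_eq[OF foot[OF x], of v] Dd[OF foot[OF x]] d_nz linD[of "foot x"] foot[OF x]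
      by (simp add: N_def d0_def linear_scale)
    have "(\<sigma> has_derivative (\<lambda>v. - D (foot x) v / D (foot x) d0 / norm d)) (at x)"
      unfolding \<sigma>_def[abs_def] D_def foot0
      by (rule bounded_linear.has_derivative[OF bounded_linear_divide der0[OF x]])
    then show ?thesis unfolding eq .
  qed
  define A where "A q = frechet_derivative \<nu> (at q)" for q
  have linA: "linear (A q)" if "q \<in> U" for q
    using linear_frechet_derivative_smooth[OF \<nu>(2)] that UV by (auto simp: A_def)
  \<comment> \<open>The derivative of \<open>foot\<close> is the projection to the tangent space
    along \<open>d\<close>, so \<open>\<nu>\<close> is only differentiated in tangent
    directions.\<close>
  define N' where "N' x v = A (foot x) (v - (N x \<bullet> v / c) *\<^sub>R d)" for x v
  have der_foot: "(foot has_derivative (\<lambda>v. v - (N x \<bullet> v / c) *\<^sub>R d)) (at x)" if "x \<in> ball p r" for x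
    unfolding foot_def[abs_def]
    using has_derivative_add[OF has_derivative_ident has_derivative_scaleR_left[OF der\<sigma>[OF that], of d]]
    by simp
  have derN: "(N has_derivative N' x) (at x)" if x: "x \<in> ball p r" for x
    unfolding N_def[abs_def] N'_def[abs_def] A_def
    using has_derivative_compose[OF der_foot[OF x] smooth_on_has_derivative[OF \<nu>(2)]] foot[OF x] UV
    by (auto simp: N_def)
  have N'_zero: "N' x = (\<lambda>v. 0)" if x: "x \<in> ball p r" for x
  proof (rule divergence_constant_gradient_constant[OF open_ball x derN])
    show "norm (N y) = 1" if "y \<in> ball p r" for y
      using n1[OF foot[OF that]] by (simp add: N_def)
    \<comment> \<open>\<open>N'\<close> is, up to the factor \<open>- c\<close>, the Hessian of
      \<open>\<sigma>\<close>.\<close>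
    show "N' y v \<bullet> w = N' y w \<bullet> v" if y: "y \<in> ball p r" for y v w
    proof -
      have *: "((\<lambda>y. - (N y \<bullet> v) / c) has_derivative (\<lambda>w. - (N' y w \<bullet> v) / c)) (at y)" for v
        using bounded_linear.has_derivative[OF bounded_linear_divide[of c]
            has_derivative_minus[OF has_derivative_inner_left[OF derN[OF y], of v]]] .
      from symmetric_second_derivative[OF open_ball y der\<sigma> *[of v] *[of w]] c0
      show ?thesis by simp
    qed
    \<comment> \<open>The oblique projection does not change the trace, so the divergence is minus
      the trace of the shape operator at the foot point.\<close>
    show "(\<Sum>b\<in>Basis. N' y b \<bullet> b) = - (H * (real DIM('a) - 1))" if y: "y \<in> ball p r" for y
    proof -
      note q = foot[OF y]
      obtain B where B: "orthonormal_basis B (tangent_space M (foot y))"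
        using orthonormal_basis_exists subspace_tangent_space[OF LE] q by blast
      have "(\<Sum>b\<in>Basis. N' y b \<bullet> b) = (\<Sum>b\<in>B. A (foot y) b \<bullet> b)"
        unfolding N'_def N_def
      proof (rule trace_oblique_projection)
        show "A (foot y) v \<bullet> \<nu> (foot y) = 0" if "\<nu> (foot y) \<bullet> v = 0" for v
          unfolding A_def
          by (rule unit_normal_field_derivative_tangent[OF V(2)]) (use q UV T[OF q] that in auto)
      qed (use q linA B T[OF q] n1[OF q] \<nu>d[OF q] c0 in auto)
      moreover have "mean_curvature M \<nu> (foot y) = - (\<Sum>b\<in>B. A (foot y) b \<bullet> b) / (real DIM('a) - 1)"
        unfolding A_def by (rule mean_curvature_orthonormal_basis[OF _ B])
          (use q linA in \<open>auto simp: A_def\<close>)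
      moreover have "mean_curvature M \<nu> (foot y) = H" using V(3) q UV by auto
      moreover have "real DIM('a) - 1 \<noteq> 0" using dim by simp
      ultimately show ?thesis by (simp add: field_simps)
    qed
    \<comment> \<open>Splitting by linearity leaves derivatives of \<open>\<nu>\<close> in fixed
      directions at \<open>foot z\<close>, with a differentiable coefficient; first derivatives of
      \<open>foot\<close> and \<open>N\<close> then suffice.\<close>
    show "(\<lambda>z. N' z v) differentiable (at y)" if y: "y \<in> ball p r" for y v
    proof -
      have split: "N' z v = A (foot z) v - (N z \<bullet> v / c) *\<^sub>R A (foot z) d" if "z \<in> ball p r" for z
        using linA[of "foot z"] foot[OF that] by (simp add: N'_def linear_diff linear_scale)
      have "(\<lambda>z. A (foot z) u) differentiable (at y)" for u
      proof -
        have "((\<lambda>q. A q u) has_derivative frechet_derivative (\<lambda>q. A q u) (at (foot y))) (at (foot y))"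
          unfolding A_def
          by (rule smooth_on_has_derivative[OF smooth_on_frechet_derivative[OF \<nu>(2)]]) (use foot[OF y] UV in auto)
        from has_derivative_compose[OF der_foot[OF y] this] show ?thesis
          by (auto simp: differentiable_def)
      qed
      moreover have "(\<lambda>z. N z \<bullet> v / c) differentiable (at y)"
        using bounded_linear.has_derivative[OF bounded_linear_divide[of c]
            has_derivative_inner_left[OF derN[OF y], of v]] by (auto simp: differentiable_def)
      ultimately have "(\<lambda>z. A (foot z) v - (N z \<bullet> v / c) *\<^sub>R A (foot z) d) differentiable (at y)"
        by (intro differentiable_diff differentiable_scaleR)
      then obtain L where "((\<lambda>z. A (foot z) v - (N z \<bullet> v / c) *\<^sub>R A (foot z) d) has_derivative L) (at y)"
        by (auto simp: differentiable_def)
      from has_derivative_transform_within_open[OF this open_ball y, of "\<lambda>z. N' z v"] split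
      show ?thesis by (auto simp: differentiable_def)
    qed
  qed
  have p_ball: "p \<in> ball p r" using r by simp
  have N_const: "N x = N p" if x: "x \<in> ball p r" for x
  proof (rule has_derivative_zero_unique[OF convex_ball _ x p_ball])
    show "(N has_derivative (\<lambda>h. 0)) (at y within ball p r)" if "y \<in> ball p r" for y
      using derN[OF that] N'_zero[OF that] has_derivative_at_withinI by metis
  qed
  have "\<sigma> p = 0" using g0[OF p_ball] gp by simp
  have \<sigma>_eq: "\<sigma> x = - (N p \<bullet> (x - p)) / c" if x: "x \<in> ball p r" for x
  proof -
    have "\<sigma> x + (N p \<bullet> (x - p)) / c = \<sigma> p + (N p \<bullet> (p - p)) / c"
    proof (rule has_derivative_zero_unique[OF convex_ball _ x p_ball])
      fix y assume y: "y \<in> ball p r"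
      have "((\<lambda>x. (N p \<bullet> (x - p)) / c) has_derivative (\<lambda>v. N p \<bullet> v / c)) (at y)"
        by (rule bounded_linear.has_derivative[OF bounded_linear_divide])
           (auto intro!: derivative_eq_intros)
      from has_derivative_add[OF der\<sigma>[OF y] this]
      have "((\<lambda>x. \<sigma> x + (N p \<bullet> (x - p)) / c) has_derivative (\<lambda>h. 0)) (at y)"
        by (simp add: N_const[OF y])
      then show "((\<lambda>x. \<sigma> x + (N p \<bullet> (x - p)) / c) has_derivative (\<lambda>h. 0)) (at y within ball p r)"
        by (rule has_derivative_at_withinI)
    qed
    then show ?thesis using \<open>\<sigma> p = 0\<close> by simp
  qed
  have "M \<inter> ball p r = {x \<in> ball p r. N p \<bullet> (x - p) = 0}"
  proof -
    have "x \<in> M \<longleftrightarrow> N p \<bullet> (x - p) = 0" if "x \<in> ball p r" for x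
    proof -
      have "x \<in> M \<longleftrightarrow> g x = 0" using that r g(2) by blast
      also have "\<dots> \<longleftrightarrow> N p \<bullet> (x - p) = 0" using g0[OF that] \<sigma>_eq[OF that] c0 by simp
      finally show ?thesis .
    qed
    then show ?thesis by blast
  qed
  moreover have "norm (N p) = 1" using n1[OF foot[OF p_ball]] by (simp add: N_def)
  ultimately show ?thesis using r(1) by blast
qed

section \<open>Gluing local hyperplanes\<close>

lemma hyperplane_eq_if_eq_on_ball:
  fixes a b x :: "'a::real_inner"
  assumes "e > 0" "\<And>z. z \<in> ball x e \<Longrightarrow> a \<bullet> (z - x) = 0 \<longleftrightarrow> b \<bullet> (z - x) = 0"
  shows "a \<bullet> (y - x) = 0 \<longleftrightarrow> b \<bullet> (y - x) = 0"
proof -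
  \<comment> \<open>Both conditions are homogeneous in \<open>y - x\<close>, so \<open>y\<close> may
    be moved towards \<open>x\<close> into the ball.\<close>
  define s where "s = e / (2 * (norm (y - x) + 1))"
  have pos: "2 * (norm (y - x) + 1) > 0" by (simp add: add_nonneg_pos)
  then have "s > 0" using assms(1) by (simp add: s_def)
  have "s * norm (y - x) < e"
  proof -
    have "s * norm (y - x) \<le> s * (norm (y - x) + 1)" using \<open>s > 0\<close> by simp
    also have "\<dots> = e / 2" using pos by (simp add: s_def field_simps)
    finally show ?thesis using assms(1) by simp
  qed
  then have "x + s *\<^sub>R (y - x) \<in> ball x e" using \<open>s > 0\<close> by (simp add: dist_norm)
  from assms(2)[OF this] \<open>s > 0\<close> show ?thesis by simp
qed

text \<open>The plane attached to a point is locally constant along \<open>M\<close>: near a common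
  point of \<open>M\<close>, two such planes both coincide with \<open>M\<close>, hence agree.
  Connectedness then leaves a single plane.\<close>

lemma connected_locally_hyperplane:
  fixes M :: "'a::euclidean_space set"
  assumes "connected M" "p0 \<in> M"
    and loc: "\<And>p. p \<in> M \<Longrightarrow> \<exists>n r. norm n = 1 \<and> r > 0 \<and> M \<inter> ball p r = {x \<in> ball p r. n \<bullet> (x - p) = 0}"
  obtains n b where "norm n = 1" "openin (top_of_set {x. n \<bullet> x = b}) M"
proof -
  obtain n r where nr: "\<And>p. p \<in> M \<Longrightarrow> norm (n p :: 'a) = 1 \<and> (r p :: real) > 0 \<and>
      M \<inter> ball p (r p) = {x \<in> ball p (r p). n p \<bullet> (x - p) = 0}"
    using loc by metis
  define P where "P p = {x. n p \<bullet> (x - p) = 0}" for p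
  have eqP: "P p = P q" if "p \<in> M" "q \<in> M" for p q
  proof (rule connected_equivalence_relation[OF assms(1) that, where R = "\<lambda>x y. P x = P y"])
    fix p assume p: "p \<in> M"
    have "P p = P x" if x: "x \<in> M \<inter> ball p (r p)" for x
    proof -
      have xM: "x \<in> M" "x \<in> ball p (r p)" using x by auto
      have npx: "n p \<bullet> (x - p) = 0" using nr[OF p] x by blast
      then have *: "n p \<bullet> (y - p) = n p \<bullet> (y - x)" for y by (simp add: inner_diff_right)
      have "x \<in> ball p (r p) \<inter> ball x (r x)" using xM nr[OF xM(1)] by simp
      then obtain e where e: "e > 0" "ball x e \<subseteq> ball p (r p) \<inter> ball x (r x)"
        by (meson open_Int open_ball openE)
      have "n p \<bullet> (z - x) = 0 \<longleftrightarrow> n x \<bullet> (z - x) = 0" if z: "z \<in> ball x e" for z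
      proof -
        have zz: "z \<in> ball p (r p)" "z \<in> ball x (r x)" using z e by auto
        have "z \<in> M \<longleftrightarrow> n p \<bullet> (z - p) = 0" using nr[OF p] zz by blast
        moreover have "z \<in> M \<longleftrightarrow> n x \<bullet> (z - x) = 0" using nr[OF xM(1)] zz by blast
        ultimately show ?thesis using * by simp
      qed
      from hyperplane_eq_if_eq_on_ball[OF e(1) this] show ?thesis
        by (simp add: P_def * set_eq_iff)
    qed
    moreover have "openin (top_of_set M) (M \<inter> ball p (r p))" by (simp add: openin_open_Int)
    moreover have "p \<in> M \<inter> ball p (r p)" using nr[OF p] p by simp
    ultimately show "\<exists>T. openin (top_of_set M) T \<and> p \<in> T \<and> (\<forall>x\<in>T. P p = P x)" by blast
  qed auto
  have "openin (top_of_set (P p0)) M"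
    unfolding openin_contains_ball
  proof (intro conjI ballI)
    show "M \<subseteq> P p0"
    proof
      fix q assume "q \<in> M"
      have "q \<in> P q" by (simp add: P_def)
      then show "q \<in> P p0" using eqP[OF \<open>q \<in> M\<close> assms(2)] by simp
    qed
    fix q assume q: "q \<in> M"
    have "ball q (r q) \<inter> P q = M \<inter> ball q (r q)" unfolding P_def using nr[OF q] by blast
    then have "ball q (r q) \<inter> P p0 \<subseteq> M" using eqP[OF q assms(2)] by auto
    then show "\<exists>e>0. ball q e \<inter> P p0 \<subseteq> M" using nr[OF q] by blast
  qed
  moreover have "P p0 = {x. n p0 \<bullet> x = n p0 \<bullet> p0}" by (simp add: P_def inner_diff_right)
  ultimately show thesis using that[of "n p0" "n p0 \<bullet> p0"] nr[OF assms(2)] by simp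
qed

text \<open>The constant field \<open>n\<close> is a global unit normal and has derivative
  zero.\<close>

lemma totally_geodesic_if_subset_hyperplane:
  assumes "M \<subseteq> {x. n \<bullet> x = b}" "norm n = 1"
  shows "totally_geodesic M"
proof -
  have "n \<bullet> v = 0" if "v \<in> tangent_space M q" for q v
    by (rule tangent_space_derivative[OF that, of "\<lambda>x. n \<bullet> x" "\<lambda>x. n \<bullet> x" UNIV b])
       (use assms in \<open>auto intro!: derivative_eq_intros\<close>)
  then have "unit_normal_field M UNIV (\<lambda>x. n)"
    using assms(2) by (simp add: unit_normal_field_def)
  moreover have "shape_operator (\<lambda>x. n) q v = 0" for q v
    by (simp add: shape_operator_def)
  ultimately show ?thesis unfolding totally_geodesic_def by (metis UNIV_I inner_zero_left)
qed

section \<open>Tangential axis\<close>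

text \<open>The reflection in the hyperplane orthogonal to \<open>d - e\<close>; for
  \<open>d = e\<close> the formula gives the identity. An involution is its own inverse, so one map
  serves for both changes of coordinates.\<close>

lemma orthogonal_involution_exists:
  fixes d e :: "'a::euclidean_space"
  assumes "norm d = 1" "norm e = 1"
  obtains f where "orthogonal_transformation f" "\<And>x. f (f x) = x" "f d = e"
proof -
  define w where "w = d - e"
  define f where "f x = x - (2 * (x \<bullet> w) / (w \<bullet> w)) *\<^sub>R w" for x
  have lin: "linear f"
    by (rule linearI) (auto simp: f_def inner_left_distrib add_divide_distrib algebra_simps)
  have "f x \<bullet> f y = x \<bullet> y" for x y
  proof (cases "w = 0")
    case False
    have "f x \<bullet> f y = x \<bullet> y - 2 * (y \<bullet> w) / (w \<bullet> w) * (x \<bullet> w) - 2 * (x \<bullet> w) / (w \<bullet> w) * (y \<bullet> w)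
        + 2 * (x \<bullet> w) / (w \<bullet> w) * (2 * (y \<bullet> w) / (w \<bullet> w) * (w \<bullet> w))"
      unfolding f_def inner_diff_left inner_diff_right inner_scaleR_left inner_scaleR_right
      by (simp add: inner_commute[of w y])
    then show ?thesis using False by simp
  qed (simp add: f_def)
  then have "orthogonal_transformation f" using lin by (simp add: orthogonal_transformation_def)
  moreover have "f (f x) = x" for x
  proof (cases "w = 0")
    case False
    then have "f x \<bullet> w = - (x \<bullet> w)" by (simp add: f_def inner_diff_left)
    then have "f (f x) = f x + (2 * (x \<bullet> w) / (w \<bullet> w)) *\<^sub>R w"
      unfolding f_def[of "f x"] by simp
    then show ?thesis by (simp add: f_def)
  qed (simp add: f_def)
  moreover have "f d = e"
  proof (cases "w = 0")
    case False
    have "w \<bullet> w = 2 * (d \<bullet> w)"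
    proof -
      have "d \<bullet> d = 1" "e \<bullet> e = 1" using assms by (simp_all add: dot_square_norm)
      then show ?thesis unfolding w_def inner_diff_left inner_diff_right by (simp add: inner_commute[of e d])
    qed
    moreover from this False have "d \<bullet> w \<noteq> 0" by (metis inner_eq_zero_iff mult_zero_right)
    ultimately have "f d = d - w" by (simp add: f_def)
    then show ?thesis by (simp add: w_def)
  qed (simp add: f_def w_def)
  ultimately show thesis by (rule that)
qed

text \<open>The height of points over \<open>M\<close> does not change along the tangent axis, so in
  the coordinates given by \<open>f\<close> a box meets \<open>M\<close> in a product. Its base is
  the slice of \<open>M\<close> through \<open>p\<close> orthogonal to \<open>d\<close>.\<close>

lemma locally_cylinder:
  fixes M :: "(real \<times> (real ^ 'n)) set"
  assumes M: "hypersurface M" and p: "p \<in> M"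
    and comp: "\<And>q n. q \<in> M \<Longrightarrow> norm n = 1 \<Longrightarrow> \<forall>v\<in>tangent_space M q. n \<bullet> v = 0 \<Longrightarrow> n \<bullet> d = 0"
    and V: "p \<in> V" "unit_normal_field M V \<nu>" "\<And>q. q \<in> M \<inter> V \<Longrightarrow> mean_curvature M \<nu> q = H"
    and f: "orthogonal_transformation f" "\<And>x. f (f x) = x" "f d = (1, 0)"
  shows "\<exists>U N. open U \<and> p \<in> U \<and> hypersurface N \<and> constant_mean_curvature N \<and>
           openin (top_of_set (UNIV \<times> N)) (f ` (M \<inter> U))"
proof -
  have linf: "linear f" and f_inner: "f v \<bullet> f w = v \<bullet> w" for v w
    using f(1) unfolding orthogonal_transformation_def by blast+
  have f_norm: "norm (f v) = norm v" for v
    using f(1) unfolding orthogonal_transformation by blast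
  have dd: "d \<bullet> d = 1" using f_inner[of d d] f(3) by simp
  obtain U0 g where U0: "p \<in> U0" "local_equation M U0 g"
    using M p by (auto simp: hypersurface_local_equation)
  have \<nu>: "open V" "smooth_on \<nu> V"
      "\<And>q. q \<in> M \<inter> V \<Longrightarrow> norm (\<nu> q) = 1 \<and> (\<forall>v\<in>tangent_space M q. \<nu> q \<bullet> v = 0)"
    using V(2) by (auto simp: unit_normal_field_def)
  define U where "U = U0 \<inter> V"
  have "open U" using U0(2) \<nu>(1) by (auto simp: U_def local_equation_def)
  have pU: "p \<in> U" and UV: "U \<subseteq> V" using U0 V by (auto simp: U_def)
  have LE: "local_equation M U g"
    using local_equation_subset[OF U0(2) \<open>open U\<close>] by (auto simp: U_def)
  have g: "smooth_on g U" "M \<inter> U = {x \<in> U. g x = 0}" using LE by (auto simp: local_equation_def)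
  define D where "D q = frechet_derivative g (at q)" for q
  have linD: "linear (D q)" if "q \<in> U" for q
    using linear_frechet_derivative_smooth[OF g(1) that] by (simp add: D_def)
  have TD: "tangent_space M q = {v. D q v = 0}" if "q \<in> M \<inter> U" for q
    using tangent_space_level_set[OF LE] that by (auto simp: D_def)
  have n1: "norm (\<nu> q) = 1" and T: "tangent_space M q = {v. \<nu> q \<bullet> v = 0}" if "q \<in> M \<inter> U" for q
    using tangent_space_eq_normal_complement[OF LE, of q "\<nu> q"] \<nu>(3)[of q] that UV by auto
  have \<nu>d: "\<nu> q \<bullet> d = 0" if "q \<in> M \<inter> V" for q
    using comp[of q "\<nu> q"] \<nu>(3)[of q] that by auto
  have Dd: "D q d = 0" if "q \<in> M \<inter> U" for q
    using T[OF that] TD[OF that] \<nu>d[of q] that UV by auto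
  \<comment> \<open>The axis is tangent, so the normal at \<open>p\<close> serves as the transversal
    direction.\<close>
  define e where "e = \<nu> p"
  have e1: "norm e = 1" using n1 p pU by (simp add: e_def)
  have "e \<notin> tangent_space M p"
    using T[of p] p pU e1 by (auto simp: e_def)
  then have De: "frechet_derivative g (at p) e \<noteq> 0" using TD[of p] p pU by (simp add: D_def)
  have gp: "g p = 0" using g p pU by blast
  obtain r \<sigma> where r: "r > 0" "ball p r \<subseteq> U"
    and lift: "\<And>x. x \<in> ball p r \<Longrightarrow> x + \<sigma> x *\<^sub>R e \<in> U \<and> g (x + \<sigma> x *\<^sub>R e) = 0 \<and>
        frechet_derivative g (at (x + \<sigma> x *\<^sub>R e)) e \<noteq> 0 \<and> (g x = 0 \<longleftrightarrow> \<sigma> x = 0)"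
    and der: "\<And>x. x \<in> ball p r \<Longrightarrow> (\<sigma> has_derivative
        (\<lambda>v. - frechet_derivative g (at (x + \<sigma> x *\<^sub>R e)) v /
             frechet_derivative g (at (x + \<sigma> x *\<^sub>R e)) e)) (at x)"
    by (rule implicit_function_along[OF \<open>open U\<close> g(1) pU gp e1 De]) blast+
  have M_iff: "x \<in> M \<longleftrightarrow> \<sigma> x = 0" if "x \<in> ball p r" for x
  proof -
    have "x \<in> M \<longleftrightarrow> g x = 0" using that r g(2) by blast
    then show ?thesis using lift[OF that] by simp
  qed
  \<comment> \<open>The derivative of \<open>\<sigma>\<close> along \<open>d\<close> is a multiple
    of that of \<open>g\<close> along \<open>d\<close> at a foot point, where \<open>d\<close> is
    tangent. The whole segment must stay in the ball in order to integrate this.\<close>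
  have \<sigma>_line: "\<sigma> (x + s *\<^sub>R d) = \<sigma> x"
    if x: "\<And>u. \<bar>u\<bar> \<le> \<bar>s\<bar> \<Longrightarrow> x + u *\<^sub>R d \<in> ball p r" for x s
  proof -
    have "\<sigma> (x + s *\<^sub>R d) = \<sigma> (x + 0 *\<^sub>R d)"
    proof (rule has_derivative_zero_unique[where f = "\<lambda>u. \<sigma> (x + u *\<^sub>R d)" and s = "{-\<bar>s\<bar>..\<bar>s\<bar>}"
          and x = s and y = 0])
      fix u assume "u \<in> {-\<bar>s\<bar>..\<bar>s\<bar>}"
      then have u: "x + u *\<^sub>R d \<in> ball p r" by (intro x) auto
      define q where "q = (x + u *\<^sub>R d) + \<sigma> (x + u *\<^sub>R d) *\<^sub>R e"
      have q: "q \<in> M \<inter> U" using lift[OF u] g(2) by (simp add: q_def)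
      have "D q (h *\<^sub>R d) = 0" for h using Dd[OF q] linD[of q] q by (simp add: linear_scale)
      moreover have "((\<lambda>u. x + u *\<^sub>R d) has_derivative (\<lambda>h. h *\<^sub>R d)) (at u)"
        by (auto intro!: derivative_eq_intros)
      from has_derivative_compose[OF this der[OF u]]
      have "((\<lambda>u. \<sigma> (x + u *\<^sub>R d)) has_derivative (\<lambda>h. - D q (h *\<^sub>R d) / D q e)) (at u)"
        by (simp add: D_def q_def)
      ultimately show "((\<lambda>u. \<sigma> (x + u *\<^sub>R d)) has_derivative (\<lambda>h. 0)) (at u within {-\<bar>s\<bar>..\<bar>s\<bar>})"
        by (simp add: has_derivative_at_withinI)
    qed auto
    then show ?thesis by simp
  qed
  obtain t0 y0 where fp: "f p = (t0, y0)" by (cases "f p")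
  \<comment> \<open>Half radii: the norm of a pair is at most the sum of the norms, so the box is
    carried by \<open>f\<close> into the ball.\<close>
  define I where "I = ball t0 (r / 2)"
  define B where "B = ball y0 (r / 2)"
  define J where "J y = f (0, y)" for y :: "real ^ 'n"
  define a where "a = f (t0, 0)"
  \<comment> \<open>As \<open>f\<close> is its own inverse, \<open>L y\<close> is the point with
    rotated coordinates \<open>(t0, y)\<close>; thus \<open>L\<close> parametrizes the slice through
    \<open>p\<close>.\<close>
  define L where "L y = a + J y" for y
  have linJ: "linear J"
    by (rule linearI) (auto simp: J_def linear_add[OF linf, symmetric] linear_scale[OF linf, symmetric])
  have f_split: "f (t, y) = L y + (t - t0) *\<^sub>R d" for t y
  proof -
    have "d = f (1, 0)" using f(2)[of d] f(3) by simp
    then have "L y + (t - t0) *\<^sub>R d = f ((t0, 0) + (0, y) + (t - t0) *\<^sub>R (1, 0))"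
      unfolding L_def a_def J_def by (simp only: linear_add[OF linf] linear_scale[OF linf])
    then show ?thesis by simp
  qed
  have v_split: "v = fst (f v) *\<^sub>R d + J (snd (f v))" for v
  proof -
    have "d = f (1, 0)" using f(2)[of d] f(3) by simp
    then have "fst (f v) *\<^sub>R d + J (snd (f v)) = f (fst (f v) *\<^sub>R (1, 0) + (0, snd (f v)))"
      unfolding J_def by (simp only: linear_add[OF linf] linear_scale[OF linf])
    then show ?thesis using f(2) by simp
  qed
  have box: "f (t, y) \<in> ball p r" if "t \<in> I" "y \<in> B" for t y
  proof -
    have "dist p (f (t, y)) = norm (f (f p - (t, y)))"
      by (simp add: linear_diff[OF linf] f(2) dist_norm)
    also have "\<dots> = norm (t0 - t, y0 - y)" by (simp add: f_norm fp)
    also have "\<dots> \<le> norm (t0 - t) + norm (y0 - y)" by (rule norm_Pair_le)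
    also have "\<dots> < r" using that by (simp add: I_def B_def dist_norm)
    finally show ?thesis by simp
  qed
  have t0I: "t0 \<in> I" using r by (simp add: I_def)
  have L_eq: "L y = f (t0, y)" for y using f_split[of t0 y] by simp
  have LU: "L y \<in> ball p r" "L y \<in> U" if "y \<in> B" for y
    using box[OF t0I that] r(2) by (auto simp: L_eq)
  define N where "N = {y \<in> B. L y \<in> M}"
  define W where "W = f -` (I \<times> B)"
  have "open W"
    unfolding W_def by (rule open_vimage) (auto simp: I_def B_def open_Times linear_continuous_on
        linf linear_linear[symmetric] linear_continuous_on[OF linear_conv_bounded_linear[THEN iffD1, OF linf]])
  have pW: "p \<in> W" using r by (simp add: W_def fp I_def B_def)
  have "f (t, y) \<in> M \<longleftrightarrow> L y \<in> M" if "t \<in> I" "y \<in> B" for t y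
  proof -
    have "\<sigma> (L y + (t - t0) *\<^sub>R d) = \<sigma> (L y)"
    proof (rule \<sigma>_line)
      fix u assume "\<bar>u\<bar> \<le> \<bar>t - t0\<bar>"
      then have "t0 + u \<in> I" using that(1) by (auto simp: I_def dist_real_def abs_minus_commute[of t0 t])
      from box[OF this that(2)] show "L y + u *\<^sub>R d \<in> ball p r" by (simp add: f_split[of "t0 + u"])
    qed
    then show ?thesis
      using M_iff[OF box[OF that]] M_iff[OF LU(1)[OF that(2)]] by (simp add: f_split)
  qed
  then have "f ` (M \<inter> W) = I \<times> N"
  proof -
    assume *: "\<And>t y. t \<in> I \<Longrightarrow> y \<in> B \<Longrightarrow> f (t, y) \<in> M \<longleftrightarrow> L y \<in> M"
    show ?thesis
    proof (intro set_eqI iffI)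
      fix z assume "z \<in> f ` (M \<inter> W)"
      then obtain x where x: "x \<in> M" "x \<in> W" "z = f x" by blast
      obtain t y where ty: "f x = (t, y)" by (cases "f x")
      then have "t \<in> I" "y \<in> B" "f (t, y) = x" using x f(2)[of x] by (auto simp: W_def)
      then show "z \<in> I \<times> N" using * x ty by (auto simp: N_def)
    next
      fix z assume "z \<in> I \<times> N"
      then obtain t y where ty: "z = (t, y)" "t \<in> I" "y \<in> B" "L y \<in> M" by (auto simp: N_def)
      then have "f z \<in> M \<inter> W" using * f(2) by (auto simp: W_def)
      then show "z \<in> f ` (M \<inter> W)" using f(2)[of z] by (metis imageI)
    qed
  qed
  moreover have "openin (top_of_set (UNIV \<times> N)) (I \<times> N)"
    by (intro openin_Times) (auto simp: I_def)
  ultimately have opn: "openin (top_of_set (UNIV \<times> N)) (f ` (M \<inter> W))" by simp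
  have "open B" by (simp add: B_def)
  \<comment> \<open>\<open>J\<close> is an isometry onto the orthogonal complement of
    \<open>d\<close>, and \<open>snd\<close> after \<open>f\<close> is its adjoint.\<close>
  have J_inner: "J v \<bullet> J w = v \<bullet> w" "d \<bullet> J w = 0" "J w \<bullet> x = w \<bullet> snd (f x)" for v w x
    using f_inner[of "(0, v)" "(0, w)"] f_inner[of d "J w"] f_inner[of "(0, w)" "f x"]
    by (simp_all add: J_def f(2) f(3) inner_prod_def)
  define gN where "gN y = g (L y)" for y
  have gN: "(gN has_derivative (\<lambda>w. D (L y) (J w))) (at y)" if "y \<in> B" for y
    using frechet_derivative_affine_compose[OF linJ linear_ident, of g a y]
      smooth_on_has_derivative[OF g(1) LU(2)[OF that]]
    by (auto simp: gN_def[abs_def] L_def D_def differentiable_def)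
  have DgN: "frechet_derivative gN (at y) = (\<lambda>w. D (L y) (J w))" if "y \<in> B" for y
    using frechet_derivative_at[OF gN[OF that]] by simp
  have LE_N: "local_equation N B gN"
    unfolding local_equation_def
  proof (intro conjI ballI)
    show "smooth_on gN B"
      using smooth_on_subset[OF smooth_on_affine_compose[OF linJ linear_ident \<open>open U\<close> g(1), of a], of B] LU
      by (auto simp: gN_def[abs_def] L_def)
    show "N \<inter> B = {y \<in> B. gN y = 0}"
      using LU(2) g(2) by (auto simp: N_def gN_def)
    fix y assume y: "y \<in> N \<inter> B"
    then have q: "L y \<in> M \<inter> U" using LU by (auto simp: N_def)
    then obtain v where v: "D (L y) v \<noteq> 0" using LE unfolding local_equation_def D_def by blast
    \<comment> \<open>The \<open>d\<close> component of \<open>v\<close> contributes nothing, so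
      regularity survives restriction to the slice.\<close>
    have "D (L y) v = fst (f v) * D (L y) d + D (L y) (J (snd (f v)))"
      using q by (subst v_split[of v]) (simp add: linear_add[OF linD] linear_scale[OF linD])
    then show "\<exists>w. frechet_derivative gN (at y) w \<noteq> 0"
      using v Dd[OF q] DgN[of y] y by auto
  qed (rule \<open>open B\<close>)
  have "hypersurface N"
    unfolding hypersurface_local_equation using LE_N by (auto simp: N_def)
  have TN: "tangent_space N y = {w. J w \<in> tangent_space M (L y)}" if "y \<in> N" for y
    using tangent_space_level_set[OF LE_N that] TD[of "L y"] DgN[of y] LU(2)[of y] that
    by (auto simp: N_def)
  \<comment> \<open>Since \<open>\<nu>\<close> is orthogonal to \<open>d\<close> on
    \<open>M\<close>, its image under \<open>f\<close> has first component 0 there, and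
    \<open>snd\<close> loses nothing.\<close>
  define \<nu>N where "\<nu>N y = snd (f (\<nu> (L y)))" for y
  have lin_sf: "linear (\<lambda>x. snd (f x))"
    using linear_compose[OF linf linear_snd] by (simp add: o_def)
  define A where "A q = frechet_derivative \<nu> (at q)" for q
  have normal: "unit_normal_field N B \<nu>N"
    unfolding unit_normal_field_def
  proof (intro conjI ballI)
    have "smooth_on \<nu> U" using smooth_on_subset[OF \<nu>(2) UV] .
    from smooth_on_subset[OF smooth_on_affine_compose[OF linJ lin_sf \<open>open U\<close> this, of a], of B] LU
    show "smooth_on \<nu>N B" by (auto simp: \<nu>N_def[abs_def] L_def)
    fix y assume y: "y \<in> N \<inter> B"
    then have q: "L y \<in> M \<inter> U" using LU by (auto simp: N_def)
    have "fst (f (\<nu> (L y))) = 0"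
      using f_inner[of "\<nu> (L y)" d] f(3) \<nu>d[of "L y"] q UV by (auto simp: inner_prod_def)
    then have "f (\<nu> (L y)) = (0, \<nu>N y)" by (simp add: \<nu>N_def prod_eq_iff)
    then show "norm (\<nu>N y) = 1" using f_norm[of "\<nu> (L y)"] n1[OF q] by (simp add: norm_Pair)
    fix w assume "w \<in> tangent_space N y"
    then have "\<nu> (L y) \<bullet> J w = 0" using TN[of y] T[OF q] y by auto
    then show "\<nu>N y \<bullet> w = 0" using J_inner(3)[of w "\<nu> (L y)"] by (simp add: \<nu>N_def inner_commute)
  qed (rule \<open>open B\<close>)
  \<comment> \<open>The traces for \<open>M\<close> and \<open>N\<close> agree; only the normalizing
    dimension drops from \<open>CARD('n)\<close> to \<open>CARD('n) - 1\<close>. If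
    \<open>CARD('n) = 1\<close>, both sides are 0, as division by zero gives 0.\<close>
  have "mean_curvature N \<nu>N y = H * real CARD('n) / (real CARD('n) - 1)" if y: "y \<in> N" for y
  proof -
    have q: "L y \<in> M" "L y \<in> U" "L y \<in> V" and "y \<in> B" using y LU UV by (auto simp: N_def)
    have linA: "linear (A (L y))"
      using linear_frechet_derivative_smooth[OF \<nu>(2)] q by (auto simp: A_def)
    obtain C where C: "orthonormal_basis C (tangent_space N y)"
      using orthonormal_basis_exists subspace_tangent_space[OF LE_N y \<open>y \<in> B\<close>] by blast
    have finC: "finite C" using C pairwise_orthogonal_imp_finite by (auto simp: orthonormal_basis_def)
    have "inj_on J C"
      by (rule inj_onI) (metis (no_types) J_inner(1) inner_diff_left inner_diff_right vector_eq)
    have d_tan: "d \<in> tangent_space M (L y)" using TD[of "L y"] Dd[of "L y"] q by simp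
    have sub: "subspace (tangent_space M (L y))"
      using subspace_tangent_space[OF LE] q by blast
    have "orthonormal_basis (insert d (J ` C)) (tangent_space M (L y))"
      unfolding orthonormal_basis_def
    proof (intro conjI)
      show "pairwise orthogonal (insert d (J ` C))"
        using C by (auto simp: orthonormal_basis_def pairwise_insert pairwise_image orthogonal_def
            J_inner(1,2) inner_commute[of "J _" d] pairwise_def)
      show "\<forall>b\<in>insert d (J ` C). norm b = 1"
        using C dd by (auto simp: orthonormal_basis_def norm_eq_1 J_inner(1))
      show "span (insert d (J ` C)) = tangent_space M (L y)"
      proof
        have "J ` C \<subseteq> tangent_space M (L y)"
          using C TN[OF y] span_base by (fastforce simp: orthonormal_basis_def)
        then show "span (insert d (J ` C)) \<subseteq> tangent_space M (L y)"
          using d_tan by (intro span_minimal sub) auto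
        show "tangent_space M (L y) \<subseteq> span (insert d (J ` C))"
        proof
          fix v assume v: "v \<in> tangent_space M (L y)"
          have "J (snd (f v)) = v - fst (f v) *\<^sub>R d" using v_split[of v] by (simp add: algebra_simps)
          then have "J (snd (f v)) \<in> tangent_space M (L y)"
            using v d_tan sub by (simp add: subspace_diff subspace_scale)
          then have "snd (f v) \<in> span C" using TN[OF y] C by (simp add: orthonormal_basis_def)
          then have "J (snd (f v)) \<in> span (J ` C)" using linear_span_image[OF linJ] by blast
          then have "J (snd (f v)) \<in> span (insert d (J ` C))" using span_mono[of "J ` C"] by blast
          moreover have "fst (f v) *\<^sub>R d \<in> span (insert d (J ` C))" by (simp add: span_base span_scale)
          ultimately show "v \<in> span (insert d (J ` C))" using v_split[of v] span_add by metis
        qed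
      qed
    qed
    then have "mean_curvature M \<nu> (L y) =
        - (\<Sum>b\<in>insert d (J ` C). A (L y) b \<bullet> b) / (real DIM(real \<times> (real ^ 'n)) - 1)"
      unfolding A_def by (intro mean_curvature_orthonormal_basis) (use linA in \<open>simp_all add: A_def\<close>)
    moreover have "mean_curvature M \<nu> (L y) = H" using V(3) q by blast
    \<comment> \<open>The axis adds nothing to the trace: \<open>\<nu> \<bullet> d\<close> vanishes
      on \<open>M\<close>, so its derivative along the tangent vector \<open>d\<close> is 0.\<close>
    moreover have "(\<Sum>b\<in>insert d (J ` C). A (L y) b \<bullet> b) = (\<Sum>b\<in>C. A (L y) (J b) \<bullet> J b)"
    proof -
      have "d \<notin> J ` C" using J_inner(2) dd by force
      moreover have "A (L y) d \<bullet> d = 0"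
      proof -
        have "((\<lambda>x. \<nu> x \<bullet> d) has_derivative (\<lambda>v. A (L y) v \<bullet> d)) (at (L y))"
          unfolding A_def by (intro has_derivative_inner_left smooth_on_has_derivative[OF \<nu>(2) q(3)])
        from tangent_space_derivative[OF d_tan this \<nu>(1) q(3) \<nu>d] show ?thesis by simp
      qed
      ultimately show ?thesis using finC \<open>inj_on J C\<close> by (simp add: sum.reindex)
    qed
    ultimately have "(\<Sum>b\<in>C. A (L y) (J b) \<bullet> J b) = - H * real CARD('n)"
      by (simp add: field_simps)
    moreover have "(\<Sum>b\<in>C. frechet_derivative \<nu>N (at y) b \<bullet> b) = (\<Sum>b\<in>C. A (L y) (J b) \<bullet> J b)"
    proof -
      have "(\<nu>N has_derivative (\<lambda>v. snd (f (A (L y) (J v))))) (at y)"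
        using frechet_derivative_affine_compose[OF linJ lin_sf, of \<nu> a y]
          smooth_on_has_derivative[OF \<nu>(2) q(3)]
        by (auto simp: \<nu>N_def[abs_def] L_def A_def differentiable_def)
      then have "frechet_derivative \<nu>N (at y) = (\<lambda>v. snd (f (A (L y) (J v))))"
        using frechet_derivative_at by metis
      moreover have "snd (f x) \<bullet> b = x \<bullet> J b" for b x
        using J_inner(3)[of b x] by (simp only: inner_commute[of "snd (f x)"] inner_commute[of x])
      ultimately show ?thesis by simp
    qed
    moreover have "linear (frechet_derivative \<nu>N (at y))"
      using linear_frechet_derivative_smooth normal \<open>y \<in> B\<close> by (auto simp: unit_normal_field_def)
    ultimately show ?thesis using mean_curvature_orthonormal_basis[OF _ C] by simp
  qed
  then have "constant_mean_curvature N"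
    unfolding constant_mean_curvature_def using normal by (auto simp: N_def)
  then show ?thesis using \<open>open W\<close> pW \<open>hypersurface N\<close> opn by blast
qed

section \<open>The dichotomy by the normal component of the axis\<close>

theorem theorem1p5:
  fixes M :: "(real \<times> (real ^ 'n)) set"
  assumes "hypersurface M"
    and "connected M"
    and "helix M"
    and "constant_mean_curvature M"
  shows "locally_cmc_cylinder M \<or> (open_in_hyperplane M \<and> totally_geodesic M)"
proof -
  obtain d K where d: "norm d = 1"
    and comp: "\<And>q n. q \<in> M \<Longrightarrow> norm n = 1 \<Longrightarrow> \<forall>v\<in>tangent_space M q. n \<bullet> v = 0 \<Longrightarrow> \<bar>n \<bullet> d\<bar> = K"
    by (rule helix_normal_component[OF assms(1,3)]) blast
  obtain H where H: "\<And>p. p \<in> M \<Longrightarrow> \<exists>U \<nu>. p \<in> U \<and> unit_normal_field M U \<nu> \<and>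
      (\<forall>q\<in>M \<inter> U. mean_curvature M \<nu> q = H)"
    using assms(4) unfolding constant_mean_curvature_def by blast
  show ?thesis
  \<comment> \<open>An empty \<open>M\<close> joins the cylinder case, where the condition on points
    is vacuous; gluing in the other case starts from a point.\<close>
  proof (cases "K = 0 \<or> M = {}")
    case True
    \<comment> \<open>\<open>f\<close> depends only on the axis, so the same rigid motion serves at
      every point of \<open>M\<close>.\<close>
    obtain f where f: "orthogonal_transformation f" "\<And>x. f (f x) = x" "f d = (1, 0 :: real ^ 'n)"
      by (rule orthogonal_involution_exists[OF d, of "(1, 0)"]) (auto simp: norm_Pair)
    have "\<exists>U N. open U \<and> p \<in> U \<and> hypersurface N \<and> constant_mean_curvature N \<and>
           openin (top_of_set (UNIV \<times> N)) (f ` (M \<inter> U))" if p: "p \<in> M" for p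
    proof -
      obtain V \<nu> where V: "p \<in> V" "unit_normal_field M V \<nu>" "\<And>q. q \<in> M \<inter> V \<Longrightarrow> mean_curvature M \<nu> q = H"
        using H[OF p] by blast
      show ?thesis
        by (rule locally_cylinder[OF assms(1) p _ V f]) (use comp True p in force)
    qed
    moreover have "rigid_motion f" unfolding rigid_motion_def using f(1) by (intro exI[of _ f] exI[of _ 0]) auto
    ultimately show ?thesis unfolding locally_cmc_cylinder_def by blast
  next
    case False
    then obtain p0 where p0: "p0 \<in> M" by blast
    have loc: "\<exists>n r. norm n = 1 \<and> r > 0 \<and> M \<inter> ball p r = {x \<in> ball p r. n \<bullet> (x - p) = 0}" if p: "p \<in> M" for p
    proof -
      obtain V \<nu> where V: "p \<in> V" "unit_normal_field M V \<nu>" "\<And>q. q \<in> M \<inter> V \<Longrightarrow> mean_curvature M \<nu> q = H"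
        using H[OF p] by blast
      \<comment> \<open>Guarantees that the mean curvature of \<open>M\<close> is normalized by a
        nonzero dimension and so determines the trace.\<close>
      have "2 \<le> DIM(real \<times> (real ^ 'n))" by (simp add: Suc_le_eq)
      moreover have "K \<noteq> 0" using False by simp
      ultimately show ?thesis by (rule locally_hyperplane[OF assms(1) p _ _ comp V])
    qed
    obtain n b where n: "norm n = 1" "openin (top_of_set {x. n \<bullet> x = b}) M"
      by (rule connected_locally_hyperplane[OF assms(2) p0 loc]) blast+
    have "open_in_hyperplane M"
      unfolding open_in_hyperplane_def using n by (intro exI[of _ n] exI[of _ b]) auto
    moreover have "totally_geodesic M"
      using totally_geodesic_if_subset_hyperplane[OF _ n(1)] openin_subset[OF n(2)] by simp
    ultimately show ?thesis by blast
  qed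
qed

end
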